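(* Let $d,s\ge 1$ be integers. There exists $\varepsilon>0$ such that for every $p\in[0,1]$ with $0<p_c(d)-p<\varepsilon$ and every $q\in[0,1]$ satisfying $$q\ \ge\ 8d^2\,(p_c(d)-p),$$ the anisotropic bond percolation process on $\mathbb{Z}^d\times\mathbb{Z}^s$ with parameters $(p,q)$ has an infinite open cluster $\mathbb{P}_{p,q}$-almost surely.
   Context: Let $\mathbb{Z}^{d+s}=\mathbb{Z}^d\times\mathbb{Z}^s$ be the graph whose edge set $E(\mathbb{Z}^{d+s})$ consists of all pairs of nearest neighbors of $\mathbb{Z}^{d+s}$. An edge is a $\mathbb{Z}^d$-edge (respectively a $\mathbb{Z}^s$-edge) if its two endpoints differ only in their $\mathbb{Z}^d$ component (respectively only in their $\mathbb{Z}^s$ component). In anisotropic bond percolation with parameters $(p,q)\in[0,1]^2$, each $\mathbb{Z}^d$-edge is open with probability $p$ and each $\mathbb{Z}^s$-edge is open with probability $q$, independently of all other edges; edges that are not open are closed. $\mathbb{P}_{p,q}$ denotes the corresponding product measure on $\{0,1\}^{E(\mathbb{Z}^{d+s})}$ with the $\sigma$-algebra generated by cylinder sets. An open cluster is a connected component of the random subgraph formed by all the vertices and the open edges. $p_c(d)$ denotes the critical threshold of homogeneous independent bond percolation on $\mathbb{Z}^d$ (nearest-neighbor edges, each open with the same probability $p$ independently), i.e. the supremum of those $p\in[0,1]$ for which the open cluster of the origin is infinite with probability $0$. *)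

theory Defs
  imports "HOL-Probability.Probability"
begin

text \<open>
  Dimensions are finite index types: \<open>\<int>\<^sup>d\<close> is rendered as \<^typ>\<open>int ^ 'd\<close> with
  \<open>d = CARD('d)\<close>, so that \<open>d \<ge> 1\<close> holds automatically.  All graphs below have the
  whole vertex type as vertex set, and are given by their set of (unordered) edges.
\<close>

definition l1_dist :: "int ^ 'n::finite \<Rightarrow> int ^ 'n \<Rightarrow> int" where
  "l1_dist x y = (\<Sum>i\<in>UNIV. \<bar>x $ i - y $ i\<bar>)"

definition lattice_edges :: "(int ^ 'd::finite) set set" where
  "lattice_edges = {{x, y} | x y. l1_dist x y = 1}"

definition prod_lattice_edges :: "((int ^ 'd::finite) \<times> (int ^ 's::finite)) set set" where
  "prod_lattice_edges = {{(x, u), (y, v)} | x u y v. l1_dist x y + l1_dist u v = 1}"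

definition differ_only_in_fst :: "('a \<times> 'b) set \<Rightarrow> bool" where
  "differ_only_in_fst e \<longleftrightarrow> (\<exists>x y u. x \<noteq> y \<and> e = {(x, u), (y, u)})"

text \<open>
  Configurations are functions on the edge set (\<open>True\<close> meaning open).  The product
  \<open>\<sigma>\<close>-algebra is generated by the cylinders, as each factor carries the power set of \<^typ>\<open>bool\<close>.
\<close>

definition bond_percolation :: "'v set set \<Rightarrow> ('v set \<Rightarrow> real) \<Rightarrow> ('v set \<Rightarrow> bool) measure" where
  "bond_percolation E r = Pi\<^sub>M E (\<lambda>e. measure_pmf (bernoulli_pmf (r e)))"

definition open_adj :: "'v set set \<Rightarrow> ('v set \<Rightarrow> bool) \<Rightarrow> 'v \<Rightarrow> 'v \<Rightarrow> bool" where
  "open_adj E \<omega> x y \<longleftrightarrow> {x, y} \<in> E \<and> \<omega> {x, y}"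

definition open_cluster :: "'v set set \<Rightarrow> ('v set \<Rightarrow> bool) \<Rightarrow> 'v \<Rightarrow> 'v set" where
  "open_cluster E \<omega> x = {y. (open_adj E \<omega>)\<^sup>*\<^sup>* x y}"

definition open_clusters :: "'v set set \<Rightarrow> ('v set \<Rightarrow> bool) \<Rightarrow> 'v set set" where
  "open_clusters E \<omega> = range (open_cluster E \<omega>)"

definition homogeneous_percolation :: "real \<Rightarrow> ((int ^ 'd::finite) set \<Rightarrow> bool) measure" where
  "homogeneous_percolation p = bond_percolation lattice_edges (\<lambda>_. p)"

definition critical_threshold :: "'d::finite itself \<Rightarrow> real" where
  "critical_threshold _ = Sup {p \<in> {0..1}.
     \<P>(\<omega> in (homogeneous_percolation p :: ((int ^ 'd) set \<Rightarrow> bool) measure).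
        infinite (open_cluster lattice_edges \<omega> 0)) = 0}"

definition anisotropic_percolation ::
    "real \<Rightarrow> real \<Rightarrow> (((int ^ 'd::finite) \<times> (int ^ 's::finite)) set \<Rightarrow> bool) measure" where
  "anisotropic_percolation p q =
     bond_percolation prod_lattice_edges (\<lambda>e. if differ_only_in_fst e then p else q)"

end

theory Submission
  imports Defs "HOL-Library.Transitive_Closure_Table"
begin

text \<open>
  Write \<open>p\<^sub>c\<close> for the critical threshold in dimension \<open>d\<close>. In all cases it is enough to show that the
  cluster of the origin is infinite with positive probability: by Kolmogorov's zero-one law
  (\<open>zero_one_law\<close>) an infinite cluster then exists almost surely.

  Let \<open>d \<ge> 2\<close>. The cluster of the origin in \<open>\<int>\<^sup>d \<times> \<int>\<^sup>s\<close> is explored along its projection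
  to \<open>\<int>\<^sup>d\<close>, climbing a single line in \<open>\<int>\<^sup>s\<close>. An explored vertex \<open>x\<close> has been reached
  at some level. To add a neighbour \<open>y\<close>, try the copy of the edge \<open>{x, y}\<close> on the level of \<open>x\<close>;
  if it is closed, climb to the next level and try there. For the second chance, the vertical edge
  above \<open>x\<close> is thought of as \<open>2 d\<close> parallel strands, one for each neighbour, each open with probability
  \<open>q / (2 d)\<close>; the union of the strands is open with probability at most \<open>q\<close>. Then all trials are
  independent and each succeeds with probability \<open>p' = p + (1 - p) p q / (2 d)\<close>. So the projection
  dominates the cluster of the origin in homogeneous percolation with parameter \<open>p'\<close>
  (\<open>exploration_comparison\<close>, \<open>anisotropic_dominates\<close>). For \<open>q \<ge> 8 d\<^sup>2 (p\<^sub>c - p)\<close> the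
  gain \<open>p' - p\<close> is at least \<open>4 d p (1 - p) (p\<^sub>c - p)\<close>, and \<open>p' > p\<^sub>c\<close> as soon as
  \<open>4 d p (1 - p) > 1\<close>. This holds for \<open>p\<close> below and close to \<open>p\<^sub>c\<close> because of the bounds
  \<open>1 / (2 d - 1) \<le> p\<^sub>c \<le> 5 / 6\<close>, which come from counting self-avoiding paths
  (\<open>critical_threshold_ge\<close>) and from Peierls' argument in a plane (\<open>critical_threshold_le\<close>).

  For \<open>d = 1\<close> one has \<open>p\<^sub>c = 1\<close>, and no \<open>p'\<close> can exceed it. Here Peierls' argument works directly in
  the plane \<open>\<int> \<times> \<int>\<close>, if the two kinds of edges are weighted according to their probabilities
  (\<open>planar_percolation\<close>): a closed dual contour pays \<open>2 (1 - p)\<close> for each vertical step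
  and \<open>(2 - q) / q\<close> for the horizontal run before it, and the product is less than \<open>1 / 2\<close> if
  \<open>q \<ge> 8 (1 - p)\<close>.

  Both union bounds over paths are instances of \<open>prob_trail_le\<close>.
\<close>

section \<open>Independent edges on a finite set\<close>

text \<open>
  All computations with finitely many edges use this explicit sum over the set \<open>X\<close> of open
  edges: conditioning on one edge is then a single identity, \<open>bernoulli_prob_insert\<close>.
\<close>

definition bernoulli_prob :: "'i set \<Rightarrow> ('i \<Rightarrow> real) \<Rightarrow> ('i set \<Rightarrow> bool) \<Rightarrow> real" where
  "bernoulli_prob I r A = (\<Sum>X\<in>Pow I. of_bool (A X) * ((\<Prod>i\<in>X. r i) * (\<Prod>i\<in>I - X. 1 - r i)))"

lemma bernoulli_prob_insert:
  assumes "finite I" "i \<notin> I"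
  shows "bernoulli_prob (insert i I) r A =
    r i * bernoulli_prob I r (\<lambda>X. A (insert i X)) + (1 - r i) * bernoulli_prob I r A"
proof -
  let ?w = "\<lambda>I X. (\<Prod>i\<in>X. r i) * (\<Prod>i\<in>I - X. 1 - r i)"
  have disj: "Pow I \<inter> insert i ` Pow I = {}" using assms by auto
  have inj: "inj_on (insert i) (Pow I)" using assms by (auto simp: inj_on_def)
  have "bernoulli_prob (insert i I) r A =
      (\<Sum>X\<in>Pow I. of_bool (A X) * ?w (insert i I) X) +
      (\<Sum>X\<in>Pow I. of_bool (A (insert i X)) * ?w (insert i I) (insert i X))"
    unfolding bernoulli_prob_def Pow_insert using assms disj
    by (subst sum.union_disjoint) (auto simp: sum.reindex[OF inj])
  also have "(\<Sum>X\<in>Pow I. of_bool (A X) * ?w (insert i I) X) = (1 - r i) * bernoulli_prob I r A"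
    unfolding bernoulli_prob_def sum_distrib_left
  proof (rule sum.cong[OF refl])
    fix X assume X: "X \<in> Pow I"
    then have "insert i I - X = insert i (I - X)" "i \<notin> I - X" "finite (I - X)" using assms by auto
    then show "of_bool (A X) * ?w (insert i I) X = (1 - r i) * (of_bool (A X) * ?w I X)"
      by simp
  qed
  also have "(\<Sum>X\<in>Pow I. of_bool (A (insert i X)) * ?w (insert i I) (insert i X)) =
      r i * bernoulli_prob I r (\<lambda>X. A (insert i X))"
    unfolding bernoulli_prob_def sum_distrib_left
  proof (rule sum.cong[OF refl])
    fix X assume X: "X \<in> Pow I"
    then have "insert i I - insert i X = I - X" "i \<notin> X" "finite X"
      using assms finite_subset by auto
    then show "of_bool (A (insert i X)) * ?w (insert i I) (insert i X) =
        r i * (of_bool (A (insert i X)) * ?w I X)"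
      by simp
  qed
  finally show ?thesis by simp
qed

lemma bernoulli_prob_mono_event:
  assumes "\<And>i. i \<in> I \<Longrightarrow> 0 \<le> r i \<and> r i \<le> 1" "\<And>X. X \<subseteq> I \<Longrightarrow> A X \<Longrightarrow> B X"
  shows "bernoulli_prob I r A \<le> bernoulli_prob I r B"
  unfolding bernoulli_prob_def
  by (intro sum_mono mult_right_mono mult_nonneg_nonneg prod_nonneg ballI)
     (use assms in \<open>auto intro: prod_nonneg\<close>)

lemma bernoulli_prob_nonneg:
  assumes "\<And>i. i \<in> I \<Longrightarrow> 0 \<le> r i \<and> r i \<le> 1"
  shows "0 \<le> bernoulli_prob I r A"
  using bernoulli_prob_mono_event[of I r "\<lambda>_. False" A] assms by (simp add: bernoulli_prob_def)

lemma bernoulli_prob_cong: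
  assumes "\<And>i. i \<in> I \<Longrightarrow> r i = r' i" "\<And>X. X \<subseteq> I \<Longrightarrow> A X = B X"
  shows "bernoulli_prob I r A = bernoulli_prob I r' B"
  unfolding bernoulli_prob_def
  by (intro sum.cong refl arg_cong2[where f = "(*)"] prod.cong) (use assms in auto)

lemma bernoulli_prob_True:
  assumes "finite I"
  shows "bernoulli_prob I r (\<lambda>_. True) = 1"
  using assms by induct (simp_all add: bernoulli_prob_insert, simp add: bernoulli_prob_def)

lemma bernoulli_prob_le_1:
  assumes "finite I" "\<And>i. i \<in> I \<Longrightarrow> 0 \<le> r i \<and> r i \<le> 1"
  shows "bernoulli_prob I r A \<le> 1"
  using bernoulli_prob_mono_event[of I r A "\<lambda>_. True"] bernoulli_prob_True[of I r] assms by simp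

text \<open>
  Raising the probabilities helps an increasing event, one edge at a time: by conditioning on the
  edge, the probability of the event is affine in the parameter of that edge, with slope the
  difference of the conditional probabilities given open and given closed.
\<close>

lemma bernoulli_prob_mono_param:
  assumes "finite I" "\<And>i. i \<in> I \<Longrightarrow> 0 \<le> r i \<and> r i \<le> r' i \<and> r' i \<le> 1"
    "\<And>X Y. X \<subseteq> Y \<Longrightarrow> A X \<Longrightarrow> A Y"
  shows "bernoulli_prob I r A \<le> bernoulli_prob I r' A"
  using assms
proof (induct I arbitrary: A rule: finite_induct)
  case empty
  show ?case by (simp add: bernoulli_prob_def)
next
  case (insert i I)
  let ?a = "bernoulli_prob I r (\<lambda>X. A (insert i X))" and ?b = "bernoulli_prob I r A"
  let ?a' = "bernoulli_prob I r' (\<lambda>X. A (insert i X))" and ?b' = "bernoulli_prob I r' A"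
  note up = insert.prems(2)
  have up_ins: "A (insert i X) \<Longrightarrow> A (insert i Y)" if "X \<subseteq> Y" for X Y
    by (rule up[OF Set.insert_mono[OF that]])
  have par: "0 \<le> r j \<and> r j \<le> r' j \<and> r' j \<le> 1" if "j \<in> insert i I" for j
    by (rule insert.prems(1)[OF that])
  have par': "0 \<le> r' j \<and> r' j \<le> 1" if "j \<in> I" for j
    using par[OF insertI2[OF that]] by linarith
  have a: "?a \<le> ?a'"
  proof (rule insert.hyps(3))
    show "0 \<le> r j \<and> r j \<le> r' j \<and> r' j \<le> 1" if "j \<in> I" for j
      by (rule par[OF insertI2[OF that]])
  qed (rule up_ins)
  have b: "?b \<le> ?b'"
  proof (rule insert.hyps(3))
    show "0 \<le> r j \<and> r j \<le> r' j \<and> r' j \<le> 1" if "j \<in> I" for j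
      by (rule par[OF insertI2[OF that]])
  qed (rule up)
  have ba: "?b' \<le> ?a'"
    by (rule bernoulli_prob_mono_event[OF par']) (assumption, erule up[OF subset_insertI])
  have r: "0 \<le> r i" "r i \<le> r' i" "r' i \<le> 1" using par[of i] by auto
  have "r i * ?a + (1 - r i) * ?b \<le> r i * ?a' + (1 - r i) * ?b'"
    using a b r by (intro add_mono mult_left_mono) auto
  also have "\<dots> = ?b' + r i * (?a' - ?b')" by (simp add: algebra_simps)
  also have "\<dots> \<le> ?b' + r' i * (?a' - ?b')" using ba r by (intro add_mono mult_right_mono) auto
  also have "\<dots> = r' i * ?a' + (1 - r' i) * ?b'" by (simp add: algebra_simps)
  finally show ?case using insert.hyps(1,2) by (simp add: bernoulli_prob_insert)
qed

text \<open>
  An edge outside \<open>J\<close> is in effect closed on the left, and closing edges hurts an increasing event.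
\<close>

lemma bernoulli_prob_mono_index:
  assumes "finite I" "J \<subseteq> I" "\<And>i. i \<in> I \<Longrightarrow> 0 \<le> r i \<and> r i \<le> 1"
    "\<And>X Y. X \<subseteq> Y \<Longrightarrow> A X \<Longrightarrow> A Y"
  shows "bernoulli_prob J r A \<le> bernoulli_prob I r A"
proof -
  have "bernoulli_prob J r A \<le> bernoulli_prob (J \<union> K) r A" if "finite K" "K \<subseteq> I - J" for K
    using that
  proof (induct K rule: finite_induct)
    case (insert k K)
    have f: "finite (J \<union> K)" "k \<notin> J \<union> K"
      using insert.prems insert.hyps assms(1,2) by (auto intro: finite_subset)
    have r: "0 \<le> r k" "r k \<le> 1" using assms(3)[of k] insert.prems by auto
    let ?b = "bernoulli_prob (J \<union> K) r A"
    let ?a = "bernoulli_prob (J \<union> K) r (\<lambda>X. A (insert k X))"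
    have "0 \<le> r j \<and> r j \<le> 1" if "j \<in> J \<union> K" for j
      by (rule assms(3)) (use that insert.prems assms(2) in auto)
    then have "?b \<le> ?a"
      by (rule bernoulli_prob_mono_event) (assumption, erule assms(4)[OF subset_insertI])
    then have "?b \<le> r k * ?a + (1 - r k) * ?b"
      using r mult_left_mono[of ?b ?a "r k"] by (simp add: algebra_simps)
    then show ?case using insert f by (simp add: bernoulli_prob_insert)
  qed simp
  from this[of "I - J"] assms show ?thesis by (simp add: Un_absorb1)
qed

section \<open>Cylinder events\<close>

lemma prob_space_bond_percolation: "prob_space (bond_percolation E r)"
  unfolding bond_percolation_def by (rule prob_space_PiM) (rule prob_space_measure_pmf)

lemma measurable_edge_state:
  assumes "e \<in> E"
  shows "Measurable.pred (bond_percolation E r) (\<lambda>\<omega>. \<omega> e)"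
proof -
  have "(\<lambda>\<omega>. \<omega> e) \<in> bond_percolation E r \<rightarrow>\<^sub>M measure_pmf (bernoulli_pmf (r e))"
    unfolding bond_percolation_def by (rule measurable_component_singleton[OF assms])
  then show ?thesis by (simp add: measurable_def)
qed

lemma prob_cylinder:
  assumes "finite A" "A \<subseteq> E" "\<And>e. e \<in> A \<Longrightarrow> 0 \<le> r e \<and> r e \<le> 1"
  shows "measure (bond_percolation E r) {\<omega> \<in> space (bond_percolation E r). \<forall>e\<in>A. \<omega> e = g e}
    = (\<Prod>e\<in>A. if g e then r e else 1 - r e)"
proof -
  interpret product_prob_space "\<lambda>e. measure_pmf (bernoulli_pmf (r e))" E
    by unfold_locales
  have "{\<omega> \<in> space (bond_percolation E r). \<forall>e\<in>A. \<omega> e = g e} =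
      prod_emb E (\<lambda>e. measure_pmf (bernoulli_pmf (r e))) A (Pi\<^sub>E A (\<lambda>e. {g e}))"
    unfolding bond_percolation_def prod_emb_def space_PiM
    using assms(2) by (auto simp: PiE_iff restrict_def extensional_def)
  then have "measure (bond_percolation E r) {\<omega> \<in> space (bond_percolation E r). \<forall>e\<in>A. \<omega> e = g e}
     = (\<Prod>e\<in>A. measure (measure_pmf (bernoulli_pmf (r e))) {g e})"
    unfolding bond_percolation_def using assms
    by (simp add: measure_PiM_emb)
  also have "\<dots> = (\<Prod>e\<in>A. if g e then r e else 1 - r e)"
    using assms(3) by (intro prod.cong) (auto simp: measure_pmf_single)
  finally show ?thesis .
qed

text \<open>
  The bridge between the infinite product measure and finite sums: the cylinders that fix the state
  of all edges in \<open>I\<close> partition the event.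
\<close>

lemma prob_finite_restriction:
  assumes "finite I" "I \<subseteq> E" "\<And>e. e \<in> I \<Longrightarrow> 0 \<le> r e \<and> r e \<le> 1"
  shows "measure (bond_percolation E r) {\<omega> \<in> space (bond_percolation E r). A {e \<in> I. \<omega> e}}
    = bernoulli_prob I r A" (is "measure ?M _ = _")
proof -
  interpret prob_space ?M by (rule prob_space_bond_percolation)
  let ?C = "\<lambda>X. {\<omega> \<in> space ?M. \<forall>e\<in>I. \<omega> e = (e \<in> X)}"
  have meas: "?C X \<in> sets ?M" for X
  proof -
    have "Measurable.pred ?M (\<lambda>\<omega>. \<omega> e = (e \<in> X))" if "e \<in> I" for e
    proof -
      note [measurable] = measurable_edge_state[of e E r]
      have "e \<in> E" using that assms by auto
      then show ?thesis by measurable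
    qed
    then have "Measurable.pred ?M (\<lambda>\<omega>. \<forall>e\<in>I. \<omega> e = (e \<in> X))"
      by (intro pred_intros_finite[OF assms(1)])
    then show ?thesis by measurable
  qed
  have eq: "{\<omega> \<in> space ?M. A {e \<in> I. \<omega> e}} = (\<Union>X\<in>{X \<in> Pow I. A X}. ?C X)"
  proof (intro set_eqI iffI)
    fix \<omega> assume "\<omega> \<in> {\<omega> \<in> space ?M. A {e \<in> I. \<omega> e}}"
    then show "\<omega> \<in> (\<Union>X\<in>{X \<in> Pow I. A X}. ?C X)"
      by (intro UN_I[of "{e \<in> I. \<omega> e}"]) auto
  next
    fix \<omega> assume "\<omega> \<in> (\<Union>X\<in>{X \<in> Pow I. A X}. ?C X)"
    then obtain X where X: "X \<subseteq> I" "A X" "\<omega> \<in> ?C X" by auto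
    then have "{e \<in> I. \<omega> e} = X" by auto
    with X show "\<omega> \<in> {\<omega> \<in> space ?M. A {e \<in> I. \<omega> e}}" by auto
  qed
  have "disjoint_family_on ?C {X \<in> Pow I. A X}"
    unfolding disjoint_family_on_def by auto
  then have "measure ?M {\<omega> \<in> space ?M. A {e \<in> I. \<omega> e}} = (\<Sum>X\<in>{X \<in> Pow I. A X}. measure ?M (?C X))"
    unfolding eq using assms(1) meas by (intro finite_measure_finite_Union) auto
  also have "\<dots> = (\<Sum>X\<in>{X \<in> Pow I. A X}. (\<Prod>i\<in>X. r i) * (\<Prod>i\<in>I - X. 1 - r i))"
  proof (rule sum.cong[OF refl])
    fix X assume "X \<in> {X \<in> Pow I. A X}"
    then have X: "X \<subseteq> I" by auto
    have "measure ?M (?C X) = (\<Prod>e\<in>I. if e \<in> X then r e else 1 - r e)"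
      by (rule prob_cylinder) (use assms in auto)
    also have "\<dots> = (\<Prod>i\<in>X. r i) * (\<Prod>i\<in>I - X. 1 - r i)"
      using X assms(1) by (subst prod.subset_diff[OF X]) (auto intro!: arg_cong2[where f="(*)"] prod.cong)
    finally show "measure ?M (?C X) = \<dots>" .
  qed
  also have "\<dots> = bernoulli_prob I r A"
    unfolding bernoulli_prob_def using assms(1)
    by (intro sum.mono_neutral_cong_left) auto
  finally show ?thesis .
qed

section \<open>Clusters and the zero-one law\<close>

text \<open>
  The open graph is represented by its edge set \<open>X\<close>, so that opening edges is set inclusion.
\<close>

definition linked :: "'v set set \<Rightarrow> 'v \<Rightarrow> 'v \<Rightarrow> bool" where
  "linked X = (\<lambda>x y. {x, y} \<in> X)\<^sup>*\<^sup>*"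

definition has_infinite_cluster :: "'v set set \<Rightarrow> bool" where
  "has_infinite_cluster X \<longleftrightarrow> (\<exists>x. infinite {y. linked X x y})"

lemma linked_refl [simp]: "linked X x x"
  by (simp add: linked_def)

lemma linked_trans: "linked X x y \<Longrightarrow> linked X y z \<Longrightarrow> linked X x z"
  by (simp add: linked_def)

lemma linked_edge: "{x, y} \<in> X \<Longrightarrow> linked X x y"
  by (auto simp: linked_def)

lemma linked_mono: "linked X x y \<Longrightarrow> X \<subseteq> Y \<Longrightarrow> linked Y x y"
  unfolding linked_def by (rule rtranclp_mono[THEN predicate2D]) auto

lemma open_cluster_eq: "open_cluster E \<omega> x = {y. linked {e \<in> E. \<omega> e} x y}"
  by (simp add: open_cluster_def linked_def open_adj_def[abs_def])

lemma open_clusters_infinite_iff: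
  "(\<exists>C\<in>open_clusters E \<omega>. infinite C) \<longleftrightarrow> has_infinite_cluster {e \<in> E. \<omega> e}"
  by (auto simp: open_clusters_def has_infinite_cluster_def open_cluster_eq)

lemma has_infinite_cluster_mono:
  "has_infinite_cluster X \<Longrightarrow> X \<subseteq> Y \<Longrightarrow> has_infinite_cluster Y"
  unfolding has_infinite_cluster_def
  by (elim exE, rule exI, erule infinite_super[rotated]) (auto intro: linked_mono)

text \<open>
  A cluster of \<open>X\<close> is covered by the clusters of \<open>X - F\<close> of one of its vertices and of the
  endpoints of the edges in \<open>F\<close>. These are finitely many, so if they were all finite, so would be
  the original cluster. This is what makes percolation a tail event.
\<close>

lemma has_infinite_cluster_Diff_finite:
  assumes "has_infinite_cluster X" "finite F"
  shows "has_infinite_cluster (X - F)"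
proof (rule ccontr)
  assume fin: "\<not> has_infinite_cluster (X - F)"
  obtain x where x: "infinite {y. linked X x y}"
    using assms(1) by (auto simp: has_infinite_cluster_def)
  \<comment> \<open>A member of \<open>F\<close> may be an infinite set; such a set is not an edge \<open>{y, z}\<close> and is left out.\<close>
  define V where "V = insert x (\<Union>{e \<in> F. finite e})"
  have "y \<in> (\<Union>v\<in>V. {y. linked (X - F) v y})" if "linked X x y" for y
    using that unfolding linked_def[of X]
  proof (induct rule: rtranclp_induct)
    case base
    then show ?case by (auto simp: V_def)
  next
    case (step y z)
    then obtain v where v: "v \<in> V" "linked (X - F) v y" by auto
    show ?case
    proof (cases "{y, z} \<in> F")
      case True
      have "z \<in> V" unfolding V_def
        by (rule insertI2, rule UnionI[of "{y, z}"]) (use True in auto)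
      then show ?thesis by (intro UN_I[of z]) auto
    next
      case False
      then have "linked (X - F) v z"
        using v step.hyps(2) by (auto intro: linked_trans linked_edge)
      then show ?thesis using v by auto
    qed
  qed
  then have "{y. linked X x y} \<subseteq> (\<Union>v\<in>V. {y. linked (X - F) v y})" by (intro subsetI) simp
  moreover have "finite (\<Union>v\<in>V. {y. linked (X - F) v y})"
    using assms(2) fin by (auto simp: V_def has_infinite_cluster_def)
  ultimately show False using x by (simp add: finite_subset)
qed

text \<open>
  Stated for an arbitrary random edge set on an arbitrary measurable space, because the zero-one law
  needs it for the \<open>\<sigma>\<close>-algebra generated by a tail of the edges.
\<close>

lemma measurable_linked:
  fixes x y :: "'v::countable"
  assumes "\<And>x y. Measurable.pred N (\<lambda>a. {x, y} \<in> X a)"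
  shows "Measurable.pred N (\<lambda>a. linked (X a) x y)"
proof -
  have "Measurable.pred N (\<lambda>a. ((\<lambda>x y. {x, y} \<in> X a) ^^ n) x y)" for n y
  proof (induct n arbitrary: y)
    case (Suc n)
    then show ?case using assms by (simp add: relcompp_apply)
  qed simp
  then show ?thesis unfolding linked_def rtranclp_power by simp
qed

lemma measurable_infinite_cluster:
  fixes x :: "'v::countable"
  assumes "\<And>x y. Measurable.pred N (\<lambda>a. {x, y} \<in> X a)"
  shows "Measurable.pred N (\<lambda>a. infinite {y. linked (X a) x y})"
proof -
  have "infinite S \<longleftrightarrow> (\<forall>n. \<exists>y. to_nat y \<ge> n \<and> y \<in> S)" for S :: "'v set"
  proof -
    have "infinite S \<longleftrightarrow> infinite (to_nat ` S)" by (simp add: finite_image_iff)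
    then show ?thesis unfolding infinite_nat_iff_unbounded_le by (metis image_iff)
  qed
  then show ?thesis using measurable_linked[OF assms] by simp
qed

lemma measurable_has_infinite_cluster:
  fixes X :: "'a \<Rightarrow> 'v::countable set set"
  assumes "\<And>x y. Measurable.pred N (\<lambda>a. {x, y} \<in> X a)"
  shows "Measurable.pred N (\<lambda>a. has_infinite_cluster (X a))"
  using measurable_infinite_cluster[where N = N and X = X] assms unfolding has_infinite_cluster_def by simp

lemma measurable_open_edges:
  "Measurable.pred (bond_percolation E r) (\<lambda>\<omega>. e \<in> {e \<in> E. \<omega> e})"
proof (cases "e \<in> E")
  case True
  then show ?thesis using measurable_edge_state[OF True] by simp
qed simp

text \<open>
  Enumerate the edges. Percolation does not depend on the first \<open>n\<close> of them, whatever \<open>n\<close> is, so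
  it belongs to the tail of the independent \<open>\<sigma>\<close>-algebras generated by the single edges.
\<close>

lemma zero_one_law:
  fixes E :: "'v::countable set set"
  assumes "countable E" "\<And>e. e \<in> E \<Longrightarrow> 0 \<le> r e \<and> r e \<le> 1"
  shows "measure (bond_percolation E r)
      {\<omega> \<in> space (bond_percolation E r). has_infinite_cluster {e \<in> E. \<omega> e}} \<in> {0, 1}"
    (is "measure ?M ?X \<in> _")
proof (cases "finite E")
  case True
  have "\<not> has_infinite_cluster {e \<in> E. \<omega> e}" for \<omega>
  proof
    assume "has_infinite_cluster {e \<in> E. \<omega> e}"
    moreover have "finite {e \<in> E. \<omega> e}" using True by simp
    ultimately have "has_infinite_cluster ({} :: 'v set set)"
      using has_infinite_cluster_Diff_finite by fastforce
    moreover have "{y. linked {} x y} = {x}" for x :: 'v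
    proof -
      have "y = x" if "linked {} x y" for y
        using that unfolding linked_def by (induct rule: rtranclp_induct) auto
      then show ?thesis by auto
    qed
    ultimately show False by (simp add: has_infinite_cluster_def)
  qed
  then show ?thesis by simp
next
  case False
  interpret prob_space ?M by (rule prob_space_bond_percolation)
  define e where "e = from_nat_into E"
  have bij: "bij_betw e UNIV E"
    unfolding e_def using bij_betw_from_nat_into assms(1) False by blast
  then have inj: "inj e" and eE: "e i \<in> E" for i by (auto simp: bij_betw_def)
  define G where "G i = {\<omega> \<in> space ?M. \<omega> (e i)}" for i
  have GM: "G i \<in> events" for i
    unfolding G_def using measurable_edge_state[OF eE] by measurable
  have prob_G: "prob (\<Inter>j\<in>J. G j) = (\<Prod>j\<in>J. r (e j))" if "finite J" "J \<noteq> {}" for J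
  proof -
    have "(\<Inter>j\<in>J. G j) = {\<omega> \<in> space ?M. \<forall>d\<in>e ` J. \<omega> d = True}"
      using that by (auto simp: G_def)
    then have "prob (\<Inter>j\<in>J. G j) = (\<Prod>d\<in>e ` J. r d)"
      using prob_cylinder[of "e ` J" E r "\<lambda>_. True"] that eE assms(2) by auto
    also have "\<dots> = (\<Prod>j\<in>J. r (e j))"
      by (rule prod.reindex_cong[OF inj_on_subset[OF inj]]) auto
    finally show ?thesis .
  qed
  let ?A = "\<lambda>i. sigma_sets (space ?M) {G i}"
  have sub: "{G i} \<subseteq> Pow (space ?M)" for i by (auto simp: G_def)
  have ind: "indep_sets ?A UNIV"
  proof (rule indep_sets_sigma)
    show "indep_sets (\<lambda>i. {G i}) UNIV"
      unfolding indep_events_def_alt[symmetric] indep_events_def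
      using prob_G[of "{i}" for i] by (auto simp: GM prob_G)
    show "Int_stable {G i}" for i by (simp add: Int_stable_def)
  qed
  have "?X \<in> tail_events ?A"
    unfolding tail_events_def
  proof (rule INT_I)
    fix n :: nat
    let ?B = "\<Union>(?A ` {n..})"
    define N where "N = sigma (space ?M) ?B"
    \<comment> \<open>The open edges outside the first \<open>n\<close> are measurable for the tail and have the same percolation behaviour.\<close>
    define X where "X \<omega> = {d \<in> E. \<omega> d} - e ` {..<n}" for \<omega> :: "'v set \<Rightarrow> bool"
    have B: "?B \<subseteq> Pow (space ?M)" using sigma_sets_into_sp[OF sub] by auto
    have sN: "space N = space ?M" "sets N = sigma_sets (space ?M) ?B"
      using B by (auto simp: N_def)
    have "Measurable.pred N (\<lambda>\<omega>. d \<in> X \<omega>)" for d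
    proof (cases "d \<in> E - e ` {..<n}")
      case True
      then obtain i where i: "d = e i" "n \<le> i"
        using bij by (auto simp: bij_betw_def) (metis imageE lessThan_iff not_less image_eqI)
      have "G i \<in> sets N" using i by (auto simp: sN)
      moreover have "{\<omega> \<in> space N. d \<in> X \<omega>} = G i"
        using True i by (auto simp: sN G_def X_def)
      ultimately show ?thesis by (auto simp: pred_def)
    next
      case False
      then have "(\<lambda>\<omega>. d \<in> X \<omega>) = (\<lambda>_. False)" by (auto simp: X_def)
      then show ?thesis by simp
    qed
    then have "Measurable.pred N (\<lambda>\<omega>. has_infinite_cluster (X \<omega>))"
      by (rule measurable_has_infinite_cluster)
    then have "{\<omega> \<in> space N. has_infinite_cluster (X \<omega>)} \<in> sets N" by (simp add: pred_def)
    moreover have "has_infinite_cluster (X \<omega>) \<longleftrightarrow> has_infinite_cluster {d \<in> E. \<omega> d}" for \<omega>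
      unfolding X_def
      by (meson Diff_subset finite_imageI finite_lessThan has_infinite_cluster_Diff_finite
          has_infinite_cluster_mono)
    ultimately show "?X \<in> sigma_sets (space ?M) ?B" by (simp add: sN)
  qed
  then have "prob ?X = 0 \<or> prob ?X = 1"
    by (intro kolmogorov_0_1_law[OF _ ind]) (auto intro: sigma_algebra_sigma_sets[OF sub])
  then show ?thesis by simp
qed

lemma AE_infinite_cluster:
  fixes E :: "'v::countable set set"
  assumes "countable E" "\<And>e. e \<in> E \<Longrightarrow> 0 \<le> r e \<and> r e \<le> 1"
    "measure (bond_percolation E r)
      {\<omega> \<in> space (bond_percolation E r). infinite (open_cluster E \<omega> x)} > 0"
  shows "AE \<omega> in bond_percolation E r. \<exists>C\<in>open_clusters E \<omega>. infinite C"
proof -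
  let ?M = "bond_percolation E r"
  interpret prob_space ?M by (rule prob_space_bond_percolation)
  let ?X = "{\<omega> \<in> space ?M. has_infinite_cluster {e \<in> E. \<omega> e}}"
  have meas: "Measurable.pred ?M (\<lambda>\<omega>. has_infinite_cluster {e \<in> E. \<omega> e})"
    by (intro measurable_has_infinite_cluster measurable_open_edges)
  then have X: "?X \<in> events" by measurable
  have "prob {\<omega> \<in> space ?M. infinite (open_cluster E \<omega> x)} \<le> prob ?X"
    by (rule finite_measure_mono[OF _ X]) (auto simp: has_infinite_cluster_def open_cluster_eq)
  then have "prob ?X = 1" using zero_one_law[OF assms(1,2)] assms(3) by fastforce
  then show ?thesis
    unfolding open_clusters_infinite_iff using prob_Collect_eq_1[OF X] by simp
qed

section \<open>A union bound over self-avoiding paths\<close>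

text \<open>
  A trail leaves \<open>v\<close> along good edges of the neighbourhood graph \<open>nb\<close>, never uses an edge twice
  (\<open>A\<close> collects the used ones) and never turns back at once (\<open>u\<close> is the previous vertex). A step
  from \<open>v\<close> to \<open>w\<close> earns \<open>c v w\<close> points, \<open>m\<close> points are still to be earned, and \<open>n\<close> bounds the
  number of steps. Starting with \<open>u = v\<close> leaves the first step free.
\<close>

fun trail :: "('a \<Rightarrow> 'a set) \<Rightarrow> ('a \<Rightarrow> 'a \<Rightarrow> nat) \<Rightarrow> ('a set \<Rightarrow> bool) \<Rightarrow> nat \<Rightarrow>
    'a set set \<Rightarrow> 'a \<Rightarrow> 'a \<Rightarrow> nat \<Rightarrow> bool" where
  "trail nb c good n A u v 0 = True"
| "trail nb c good 0 A u v (Suc m) = False"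
| "trail nb c good (Suc n) A u v (Suc m) =
    (\<exists>w\<in>nb v - {u}. {v, w} \<notin> A \<and> good {v, w} \<and>
      trail nb c good n (insert {v, w} A) v w (Suc m - c v w))"

text \<open>
  A self-avoiding path is a trail: each used edge contains a vertex that the rest of the path avoids.
  The potential \<open>h\<close> guarantees that the required points are earned on the way to \<open>y\<close>.
\<close>

lemma trail_of_path:
  assumes "rtrancl_path R v xs y" "distinct (v # xs)" "u \<notin> set xs"
    "\<And>a b. R a b \<Longrightarrow> b \<in> nb a \<and> good {a, b}"
    "\<And>a b. R a b \<Longrightarrow> h a - h b \<le> int (c a b)"
    "\<And>e. e \<in> A \<Longrightarrow> \<not> e \<subseteq> set (v # xs)"
    "int m \<le> h v - h y"
  shows "trail nb c good (length xs) A u v m"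
  using assms(1-3,6,7)
proof (induct arbitrary: A u m rule: rtrancl_path.induct)
  case (base x)
  then show ?case by simp
next
  case (step v w xs y)
  show ?case
  proof (cases m)
    case (Suc m')
    have "trail nb c good (length xs) (insert {v, w} A) v w (m - c v w)"
    proof (cases "m \<le> c v w")
      case False
      show ?thesis
      proof (rule step.hyps(3))
        show "distinct (w # xs)" "v \<notin> set xs" using step.prems(1) by auto
        show "\<not> e \<subseteq> set (w # xs)" if "e \<in> insert {v, w} A" for e
          using that step.prems(1) step.prems(3)[of e] by auto
        show "int (m - c v w) \<le> h w - h y"
          using False step.prems(4) assms(5)[OF step.hyps(1)] by linarith
      qed
    qed simp
    moreover have "{v, w} \<notin> A" using step.prems(3)[of "{v, w}"] by auto
    moreover have "w \<in> nb v - {u}" "good {v, w}"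
      using assms(4)[OF step.hyps(1)] step.prems by auto
    ultimately show ?thesis using Suc by auto
  qed simp
qed

context prob_space
begin

lemma measurable_trail:
  fixes good :: "'b set \<Rightarrow> 'a \<Rightarrow> bool"
  assumes "\<And>v. finite (nb v)" "\<And>v w. w \<in> nb v \<Longrightarrow> Measurable.pred M (good {v, w})"
  shows "Measurable.pred M (\<lambda>\<omega>. trail nb c (\<lambda>e. good e \<omega>) n A u v m)"
proof (induct n arbitrary: A u v m)
  case 0
  show ?case by (cases m) simp_all
next
  case (Suc n)
  show ?case
  proof (cases m)
    case (Suc m')
    have "Measurable.pred M (\<lambda>\<omega>. {v, w} \<notin> A \<and> good {v, w} \<omega> \<and>
        trail nb c (\<lambda>e. good e \<omega>) n (insert {v, w} A) v w (Suc m' - c v w))"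
      if "w \<in> nb v - {u}" for w
      using Suc.hyps assms(2)[of w v] that by simp
    then have "Measurable.pred M (\<lambda>\<omega>. \<exists>w\<in>nb v - {u}. {v, w} \<notin> A \<and> good {v, w} \<omega> \<and>
        trail nb c (\<lambda>e. good e \<omega>) n (insert {v, w} A) v w (Suc m' - c v w))"
      using assms(1) by (intro pred_intros_finite) auto
    then show ?thesis using Suc by simp
  qed simp
qed

text \<open>
  The union bound over all trails, organised as a supersolution argument instead of a sum over paths:
  if \<open>f u v m\<close> dominates the weighted sum of its values after one step, it dominates the expected
  number of trails that start in the state \<open>(u, v, m)\<close> and earn all points. The edges of a trail
  are distinct, which is why their probabilities multiply.
\<close>

lemma prob_trail_le:
  fixes good :: "'b set \<Rightarrow> 'a \<Rightarrow> bool"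
  assumes fin: "\<And>v. finite (nb v)"
    and meas: "\<And>v w. w \<in> nb v \<Longrightarrow> Measurable.pred M (good {v, w})"
    and indep: "\<And>A. finite A \<Longrightarrow> A \<subseteq> {{v, w} |v w. w \<in> nb v} \<Longrightarrow>
      prob {\<omega> \<in> space M. \<forall>e\<in>A. good e \<omega>} = (\<Prod>e\<in>A. wt e)"
    and wt: "\<And>v w. w \<in> nb v \<Longrightarrow> 0 \<le> wt {v, w}"
    and f0: "\<And>u v m. 0 \<le> f u v m" "\<And>u v. 1 \<le> f u v 0"
    and super: "\<And>u v m. (\<Sum>w\<in>nb v - {u}. wt {v, w} * f v w (Suc m - c v w)) \<le> f u v (Suc m)"
  shows "prob {\<omega> \<in> space M. \<exists>n. trail nb c (\<lambda>e. good e \<omega>) n {} u v m} \<le> f u v m"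
proof -
  let ?E = "{{v, w} |v w. w \<in> nb v}"
  note mt = measurable_trail[of nb good, OF fin meas]
  have meas': "Measurable.pred M (good e)" if "e \<in> ?E" for e using meas that by auto
  have mA: "Measurable.pred M (\<lambda>\<omega>. \<forall>e\<in>A. good e \<omega>)" if "finite A" "A \<subseteq> ?E" for A
    using that meas' by (intro pred_intros_finite) blast+
  \<comment> \<open>The induction carries along the edges used so far, to multiply their weights.\<close>
  have bound: "prob {\<omega> \<in> space M. (\<forall>e\<in>A. good e \<omega>) \<and> trail nb c (\<lambda>e. good e \<omega>) n A u v m}
      \<le> (\<Prod>e\<in>A. wt e) * f u v m" if "finite A" "A \<subseteq> ?E" for n A u v m
    using that
  proof (induct n arbitrary: A u v m)
    case (0 A u v m)
    have p: "0 \<le> (\<Prod>e\<in>A. wt e)" using indep[OF 0] by (metis measure_nonneg)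
    show ?case
    proof (cases m)
      case m: 0
      then show ?thesis using indep[OF 0] p mult_left_mono[OF f0(2) p] by simp
    next
      case (Suc m')
      then show ?thesis using p f0(1) by simp
    qed
  next
    case (Suc n A u v m)
    have p: "0 \<le> (\<Prod>e\<in>A. wt e)" using indep[OF Suc.prems] by (metis measure_nonneg)
    show ?case
    proof (cases m)
      case 0
      then show ?thesis using indep[OF Suc.prems] p mult_left_mono[OF f0(2) p] by simp
    next
      case m: (Suc m')
      let ?W = "{w \<in> nb v - {u}. {v, w} \<notin> A}"
      let ?T = "\<lambda>w. {\<omega> \<in> space M. (\<forall>e\<in>insert {v, w} A. good e \<omega>) \<and>
        trail nb c (\<lambda>e. good e \<omega>) n (insert {v, w} A) v w (m - c v w)}"
      have ins: "finite (insert {v, w} A)" "insert {v, w} A \<subseteq> ?E" if "w \<in> ?W" for w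
        using that Suc.prems by auto
      have T: "?T w \<in> events" if "w \<in> ?W" for w
        using mA[OF ins[OF that]] mt by measurable
      have "{\<omega> \<in> space M. (\<forall>e\<in>A. good e \<omega>) \<and> trail nb c (\<lambda>e. good e \<omega>) (Suc n) A u v m}
          = (\<Union>w\<in>?W. ?T w)"
        using m by auto
      then have "prob {\<omega> \<in> space M. (\<forall>e\<in>A. good e \<omega>) \<and>
          trail nb c (\<lambda>e. good e \<omega>) (Suc n) A u v m} \<le> (\<Sum>w\<in>?W. prob (?T w))"
        using T fin by (simp only:, intro finite_measure_subadditive_finite) auto
      also have "\<dots> \<le> (\<Sum>w\<in>?W. (\<Prod>e\<in>A. wt e) * (wt {v, w} * f v w (m - c v w)))"
      proof (rule sum_mono)
        fix w assume w: "w \<in> ?W"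
        show "prob (?T w) \<le> (\<Prod>e\<in>A. wt e) * (wt {v, w} * f v w (m - c v w))"
          using Suc.hyps[OF ins[OF w], of v w "m - c v w"] w Suc.prems(1)
          by (simp add: mult_ac)
      qed
      also have "\<dots> \<le> (\<Sum>w\<in>nb v - {u}. (\<Prod>e\<in>A. wt e) * (wt {v, w} * f v w (m - c v w)))"
        using fin p wt f0 by (intro sum_mono2) auto
      also have "\<dots> \<le> (\<Prod>e\<in>A. wt e) * f u v m"
        unfolding sum_distrib_left[symmetric] using super p m by (intro mult_left_mono) auto
      finally show ?thesis .
    qed
  qed
  let ?B = "\<lambda>n. {\<omega> \<in> space M. trail nb c (\<lambda>e. good e \<omega>) n {} u v m}"
  have trail_Suc: "trail nb c g n A u v m \<Longrightarrow> trail nb c g (Suc n) A u v m" for g n A u v m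
  proof (induct n arbitrary: A u v m)
    case 0
    then show ?case by (cases m) auto
  next
    case (Suc n)
    then show ?case by (cases m) fastforce+
  qed
  have "incseq ?B" by (rule incseq_SucI) (use trail_Suc in auto)
  moreover have "range ?B \<subseteq> events" using mt by auto
  ultimately have "(\<lambda>n. prob (?B n)) \<longlonglongrightarrow> prob (\<Union>n. ?B n)"
    by (intro finite_Lim_measure_incseq)
  moreover have "prob (?B n) \<le> f u v m" for n using bound[of "{}" n u v m] by simp
  ultimately have "prob (\<Union>n. ?B n) \<le> f u v m" by (intro LIMSEQ_le_const2) auto
  moreover have "(\<Union>n. ?B n) = {\<omega> \<in> space M. \<exists>n. trail nb c (\<lambda>e. good e \<omega>) n {} u v m}" by auto
  ultimately show ?thesis by simp
qed

end

section \<open>The critical threshold is at least 1 / (2d - 1)\<close>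

lemma l1_dist_commute: "l1_dist x y = l1_dist y x"
  by (simp add: l1_dist_def abs_minus_commute)

lemma l1_dist_self [simp]: "l1_dist x x = 0"
  by (simp add: l1_dist_def)

lemma l1_dist_triangle: "l1_dist x z \<le> l1_dist x y + l1_dist y z"
  unfolding l1_dist_def sum.distrib[symmetric] by (rule sum_mono) linarith

lemma l1_dist_add_axis [simp]:
  "l1_dist x (x + axis i k) = \<bar>k\<bar>" "l1_dist (x + axis i k) x = \<bar>k\<bar>"
proof -
  have "l1_dist x (x + axis i k) = (\<Sum>j\<in>UNIV. if j = i then \<bar>k\<bar> else 0)"
    unfolding l1_dist_def by (rule sum.cong) (auto simp: axis_def)
  then show "l1_dist x (x + axis i k) = \<bar>k\<bar>" by simp
  then show "l1_dist (x + axis i k) x = \<bar>k\<bar>" by (simp add: l1_dist_commute)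
qed

lemma finite_l1_ball: "finite {y :: int ^ 'n::finite. l1_dist x y \<le> n}"
proof -
  let ?S = "Pi\<^sub>E UNIV (\<lambda>i :: 'n. {x $ i - n..x $ i + n})"
  have "vec_nth ` {y. l1_dist x y \<le> n} \<subseteq> ?S"
  proof (clarsimp simp: PiE_iff)
    fix y i assume y: "l1_dist x y \<le> n"
    have "\<bar>x $ i - y $ i\<bar> \<le> l1_dist x y"
      unfolding l1_dist_def by (rule member_le_sum) auto
    with y show "x $ i - n \<le> y $ i \<and> y $ i \<le> x $ i + n" by linarith
  qed
  moreover have "finite ?S" by (intro finite_PiE) auto
  ultimately have "finite (vec_nth ` {y. l1_dist x y \<le> n})" by (rule finite_subset)
  then show ?thesis by (rule finite_imageD) (auto simp: inj_on_def vec_eq_iff)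
qed

definition neighbours :: "int ^ 'n::finite \<Rightarrow> (int ^ 'n) set" where
  "neighbours x = {y. l1_dist x y = 1}"

text \<open>
  A sum of nonnegative integers equals 1 only if one summand is 1 and all others vanish.
\<close>

lemma neighbours_eq: "neighbours x = (\<Union>i. {x + axis i 1, x + axis i (-1)})"
proof (intro equalityI subsetI)
  fix y assume "y \<in> neighbours x"
  then have y: "(\<Sum>i\<in>UNIV. \<bar>x $ i - y $ i\<bar>) = 1" by (simp add: neighbours_def l1_dist_def)
  then obtain i where i: "x $ i \<noteq> y $ i"
    by (metis (no_types, lifting) abs_zero diff_self sum.neutral zero_neq_one)
  have eq: "\<bar>x $ i - y $ i\<bar> + (\<Sum>j\<in>UNIV - {i}. \<bar>x $ j - y $ j\<bar>) = 1"
    using y by (subst (asm) sum.remove[of _ i]) auto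
  have nn: "0 \<le> (\<Sum>j\<in>UNIV - {i}. \<bar>x $ j - y $ j\<bar>)" by (auto intro: sum_nonneg)
  have 1: "\<bar>x $ i - y $ i\<bar> = 1" and "(\<Sum>j\<in>UNIV - {i}. \<bar>x $ j - y $ j\<bar>) = 0"
    using eq nn i by linarith+
  then have "\<forall>j\<in>UNIV - {i}. \<bar>x $ j - y $ j\<bar> = 0"
    by (subst (asm) sum_nonneg_eq_0_iff) auto
  then have "y = x + axis i (y $ i - x $ i)" by (auto simp: vec_eq_iff axis_def)
  moreover have "y $ i - x $ i = 1 \<or> y $ i - x $ i = -1" using 1 by linarith
  ultimately have "y \<in> {x + axis i 1, x + axis i (-1)}" by (metis insertCI)
  then show "y \<in> (\<Union>i. {x + axis i 1, x + axis i (-1)})" by blast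
qed (auto simp: neighbours_def)

lemma finite_neighbours [simp]: "finite (neighbours x)"
  by (auto simp: neighbours_eq)

lemma card_neighbours_le: "card (neighbours (x :: int ^ 'n::finite)) \<le> 2 * CARD('n)"
proof -
  have "card (neighbours x) \<le> (\<Sum>i\<in>(UNIV :: 'n set). card {x + axis i 1, x + axis i (-1)})"
    unfolding neighbours_eq by (rule card_UN_le) simp
  also have "\<dots> \<le> (\<Sum>i\<in>(UNIV :: 'n set). 2)" by (rule sum_mono) (simp add: card_insert_if)
  finally show ?thesis by simp
qed

lemma edge_in_lattice_edges: "{x, y} \<in> lattice_edges \<longleftrightarrow> l1_dist x y = 1"
  by (auto simp: lattice_edges_def doubleton_eq_iff l1_dist_commute)

lemma infinite_l1_unbounded:
  fixes S :: "(int ^ 'n::finite) set"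
  assumes "infinite S"
  obtains y where "y \<in> S" "l1_dist x y \<ge> n"
proof -
  have "\<not> S \<subseteq> {y. l1_dist x y \<le> n}" using assms finite_l1_ball finite_subset by blast
  then obtain y where "y \<in> S" "\<not> l1_dist x y \<le> n" by auto
  with that show ?thesis by auto
qed

text \<open>
  An infinite cluster of the origin contains self-avoiding open paths of every length \<open>m\<close>. Each step
  after the first has at most \<open>2 d - 1\<close> continuations, so the expected number of such paths is at
  most \<open>2 ((2 d - 1) p)\<^sup>m\<close>, which tends to 0.
\<close>

lemma prob_infinite_cluster_eq_0:
  assumes p: "0 \<le> p" "p < 1 / (2 * real CARD('d) - 1)"
  shows "\<P>(\<omega> in (homogeneous_percolation p :: ((int ^ 'd::finite) set \<Rightarrow> bool) measure).
    infinite (open_cluster lattice_edges \<omega> 0)) = 0"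
proof -
  let ?M = "homogeneous_percolation p :: ((int ^ 'd) set \<Rightarrow> bool) measure"
  define k where "k = 2 * real CARD('d) - 1"
  have "real CARD('d) \<ge> 1" by (simp add: Suc_leI)
  then have k: "k \<ge> 1" unfolding k_def by linarith
  have pk: "p < 1 / k" using p by (simp add: k_def)
  have p1: "p \<le> 1"
  proof -
    have "1 / k \<le> 1" using k by simp
    then show ?thesis using pk by linarith
  qed
  interpret prob_space ?M
    unfolding homogeneous_percolation_def by (rule prob_space_bond_percolation)
  \<comment> \<open>The factor 2 pays for the first step, which has one direction more: \<open>2 d \<le> 2 (2 d - 1)\<close>.\<close>
  define f where "f u v m = (if l1_dist v u = 1 then 1 else 2) * (k * p) ^ m" for u v :: "int ^ 'd" and m
  let ?T = "\<lambda>m \<omega>. \<exists>n. trail neighbours (\<lambda>_ _. 1) (\<lambda>e. \<omega> e) n {} (0 :: int ^ 'd) 0 m"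
  have edge: "{v, w} \<in> lattice_edges" if "w \<in> neighbours v" for v w :: "int ^ 'd"
    using that by (simp add: neighbours_def edge_in_lattice_edges)
  have meas: "Measurable.pred ?M (\<lambda>\<omega>. \<omega> {v, w})" if "w \<in> neighbours v" for v w
    unfolding homogeneous_percolation_def by (rule measurable_edge_state[OF edge[OF that]])
  have bound: "prob {\<omega> \<in> space ?M. ?T m \<omega>} \<le> f 0 0 m" for m
  proof (rule prob_trail_le[where wt = "\<lambda>_. p" and f = f])
    show "prob {\<omega> \<in> space ?M. \<forall>e\<in>A. \<omega> e} = (\<Prod>e\<in>A. p)"
      if "finite A" "A \<subseteq> {{v, w} |v w. w \<in> neighbours v}" for A
    proof -
      have "A \<subseteq> lattice_edges" using that(2) edge by blast
      then show ?thesis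
        using prob_cylinder[of A lattice_edges "\<lambda>_. p" "\<lambda>_. True"] that(1) p p1
        unfolding homogeneous_percolation_def by simp
    qed
    show "0 \<le> f u v m" for u v m using k p by (simp add: f_def)
    show "1 \<le> f u v 0" for u v by (simp add: f_def)
    show "(\<Sum>w\<in>neighbours v - {u}. p * f v w (Suc m - 1)) \<le> f u v (Suc m)" for u v m
    proof -
      have "(\<Sum>w\<in>neighbours v - {u}. p * f v w (Suc m - 1))
          = real (card (neighbours v - {u})) * (p * (k * p) ^ m)"
        by (simp add: f_def neighbours_def l1_dist_commute)
      also have "\<dots> \<le> ((if l1_dist v u = 1 then 1 else 2) * k) * (p * (k * p) ^ m)"
      proof (rule mult_right_mono)
        have "card (neighbours v - {u}) + (if l1_dist v u = 1 then 1 else 0) \<le> card (neighbours v)"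
        proof (cases "u \<in> neighbours v")
          case True
          then show ?thesis using card_Suc_Diff1[OF finite_neighbours True] by (simp add: neighbours_def)
        next
          case False
          then show ?thesis by (simp add: neighbours_def)
        qed
        also have "\<dots> \<le> 2 * CARD('d)" by (rule card_neighbours_le)
        finally have "real (card (neighbours v - {u}) + (if l1_dist v u = 1 then 1 else 0))
            \<le> real (2 * CARD('d))"
          by (rule of_nat_mono)
        then have "real (card (neighbours v - {u})) \<le>
            2 * real CARD('d) - (if l1_dist v u = 1 then 1 else 0)"
          by (auto split: if_splits)
        also have "\<dots> \<le> (if l1_dist v u = 1 then 1 else 2) * k" using k by (auto simp: k_def)
        finally show "real (card (neighbours v - {u})) \<le> (if l1_dist v u = 1 then 1 else 2) * k" .
        show "0 \<le> p * (k * p) ^ m" using k p by simp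
      qed
      also have "\<dots> = f u v (Suc m)" by (simp add: f_def)
      finally show ?thesis .
    qed
    show "Measurable.pred ?M (\<lambda>\<omega>. \<omega> {v, w})" if "w \<in> neighbours v" for v w
      using that by (rule meas)
    show "0 \<le> p" by (rule p)
    show "finite (neighbours v)" for v :: "int ^ 'd" by simp
  qed
  have le: "prob {\<omega> \<in> space ?M. infinite (open_cluster lattice_edges \<omega> 0)} \<le> 2 * (k * p) ^ m" for m
  proof -
    have "Measurable.pred ?M (?T m)"
      by (intro pred_intros_countable measurable_trail meas) auto
    then have ev: "{\<omega> \<in> space ?M. ?T m \<omega>} \<in> events" by measurable
    have "?T m \<omega>" if inf: "infinite (open_cluster lattice_edges \<omega> 0)" for \<omega>
    proof -
      obtain y where y: "y \<in> open_cluster lattice_edges \<omega> 0" "l1_dist 0 y \<ge> int m"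
        using infinite_l1_unbounded[OF inf] by blast
      then obtain xs where "rtrancl_path (open_adj lattice_edges \<omega>) 0 xs y" "distinct (0 # xs)"
        unfolding open_cluster_def mem_Collect_eq rtranclp_eq_rtrancl_path
        by (meson rtrancl_path_distinct)
      then have "trail neighbours (\<lambda>_ _. 1) (\<lambda>e. \<omega> e) (length xs) {} (0 :: int ^ 'd) 0 m"
      proof (rule trail_of_path[where h = "\<lambda>x. - l1_dist 0 x"])
        show "b \<in> neighbours a \<and> \<omega> {a, b}" if "open_adj lattice_edges \<omega> a b" for a b
          using that by (simp add: open_adj_def edge_in_lattice_edges neighbours_def)
        show "- l1_dist 0 a - - l1_dist 0 b \<le> int 1" if "open_adj lattice_edges \<omega> a b" for a b :: "int ^ 'd"
          using that l1_dist_triangle[of 0 b a] by (simp add: open_adj_def edge_in_lattice_edges)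
      qed (use y \<open>distinct (0 # xs)\<close> in auto)
      then show ?thesis by blast
    qed
    then have "prob {\<omega> \<in> space ?M. infinite (open_cluster lattice_edges \<omega> 0)}
        \<le> prob {\<omega> \<in> space ?M. ?T m \<omega>}"
      by (intro finite_measure_mono ev) auto
    also have "\<dots> \<le> 2 * (k * p) ^ m" using bound[of m] by (simp add: f_def)
    finally show ?thesis .
  qed
  have "k * p < 1" using pk k by (simp add: field_simps)
  moreover have "0 \<le> k * p" using p k by simp
  ultimately have lim: "(\<lambda>m. 2 * (k * p) ^ m) \<longlonglongrightarrow> 2 * 0" by (intro tendsto_mult_left LIMSEQ_power_zero) simp
  have "prob {\<omega> \<in> space ?M. infinite (open_cluster lattice_edges \<omega> 0)} \<le> 2 * 0"
    by (rule LIMSEQ_le_const[OF lim]) (intro exI[of _ 0] allI impI le)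
  then have "prob {\<omega> \<in> space ?M. infinite (open_cluster lattice_edges \<omega> 0)} \<le> 0" by simp
  then show ?thesis by (simp add: measure_le_0_iff)
qed

lemma critical_threshold_ge: "critical_threshold TYPE('d::finite) \<ge> 1 / (2 * real CARD('d) - 1)"
proof (rule dense_le_bounded[of 0])
  have d: "real CARD('d) \<ge> 1" by (simp add: Suc_leI)
  then have "0 < 2 * real CARD('d) - 1" by linarith
  then show "0 < 1 / (2 * real CARD('d) - 1)" by (rule divide_pos_pos[OF zero_less_one])
  fix p assume p: "0 < p" "p < 1 / (2 * real CARD('d) - 1)"
  have "1 / (2 * real CARD('d) - 1) \<le> 1"
    using frac_le[of 1 1 1 "2 * real CARD('d) - 1"] d by linarith
  then show "p \<le> critical_threshold TYPE('d)"
    unfolding critical_threshold_def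
    using p by (intro cSup_upper) (auto intro!: bdd_aboveI[of _ 1] prob_infinite_cluster_eq_0)
qed

section \<open>The contour around a finite planar cluster\<close>

text \<open>
  A unit square of \<open>\<int>\<^sup>2\<close> is named by its lower left corner, so that the squares form the dual lattice,
  in which \<open>faces v\<close> are the four neighbours of \<open>v\<close>. Two adjacent squares share exactly the two
  corners that span the lattice edge crossed by the dual edge. The contour of \<open>C\<close> consists of the
  dual edges that separate a point of \<open>C\<close> from a point outside.
\<close>

definition faces :: "int \<times> int \<Rightarrow> (int \<times> int) set" where
  "faces v = {(fst v + 1, snd v), (fst v - 1, snd v), (fst v, snd v + 1), (fst v, snd v - 1)}"

definition corners :: "int \<times> int \<Rightarrow> (int \<times> int) set" where
  "corners v = {fst v, fst v + 1} \<times> {snd v, snd v + 1}"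

definition contour_step :: "(int \<times> int) set \<Rightarrow> int \<times> int \<Rightarrow> int \<times> int \<Rightarrow> bool" where
  "contour_step C v w \<longleftrightarrow> w \<in> faces v \<and>
     (\<exists>z\<in>corners v \<inter> corners w. z \<in> C) \<and> (\<exists>z\<in>corners v \<inter> corners w. z \<notin> C)"

lemma corners_inter:
  "corners (a, b) \<inter> corners (a + 1, b) = {(a + 1, b), (a + 1, b + 1)}"
  "corners (a, b) \<inter> corners (a - 1, b) = {(a, b), (a, b + 1)}"
  "corners (a, b) \<inter> corners (a, b + 1) = {(a, b + 1), (a + 1, b + 1)}"
  "corners (a, b) \<inter> corners (a, b - 1) = {(a, b), (a + 1, b)}"
  by (auto simp: corners_def)

lemma even_sum_changes:
  "even (\<Sum>b\<in>{0..int n}. of_bool (c b \<noteq> c (b + 1)) :: int) \<longleftrightarrow> (c 0 \<longleftrightarrow> c (int n + 1))"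
proof (induct n)
  case 0
  have "(\<Sum>b\<in>{0..int 0}. f b) = f 0" for f :: "int \<Rightarrow> int" by simp
  then show ?case by (simp only:) simp
next
  case (Suc n)
  define f where "f b = (of_bool (c b \<noteq> c (b + 1)) :: int)" for b
  have "{0..int (Suc n)} = insert (int n + 1) {0..int n}" by auto
  then have "sum f {0..int (Suc n)} = f (int n + 1) + sum f {0..int n}" by simp
  moreover have "even (f (int n + 1)) \<longleftrightarrow> (c (int n + 1) \<longleftrightarrow> c (int (Suc n) + 1))"
    by (simp add: f_def add.commute)
  ultimately show ?case using Suc unfolding f_def[symmetric] by auto
qed

lemma sum_shift_int:
  fixes F :: "int \<Rightarrow> int"
  assumes "\<And>b. F b \<noteq> 0 \<Longrightarrow> \<bar>b\<bar> < M"
  shows "(\<Sum>b\<in>{-M..M}. F (b + 1)) = (\<Sum>b\<in>{-M..M}. F b)"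
proof -
  have "F (M + 1) = 0" "F (- M) = 0" using assms[of "M + 1"] assms[of "- M"] by linarith+
  then show ?thesis
    by (intro sum.reindex_bij_witness_not_neutral[where S' = "{M}" and T' = "{-M}"
          and i = "\<lambda>b. b - 1" and j = "\<lambda>b. b + 1"]) auto
qed

text \<open>
  This replaces planar duality by a parity count. Along the ray from the origin upwards the contour is
  crossed an odd number of times, as the ray starts in \<open>C\<close> and ends outside. Around every square
  there is an even number of contour edges. Let \<open>W\<close> be the set of squares that the contour reaches
  from the crossings of the upper ray. The number of contour edges within \<open>W\<close> that cross a given
  column has the same parity for all columns, and it is 0 far out; so it is even in column 0. Hence
  \<open>W\<close> contains a square to the right of the lower ray, too.
\<close>

lemma contour_surrounds:
  assumes fin: "finite C" and origin: "(0, 0) \<in> C"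
  obtains b b' where "b \<ge> 0" "b' < 0" "(contour_step C)\<^sup>*\<^sup>* (0, b) (0, b')"
proof (rule ccontr)
  assume "\<not> thesis"
  with that have no_path: "\<And>b b'. b \<ge> 0 \<Longrightarrow> b' < 0 \<Longrightarrow> \<not> (contour_step C)\<^sup>*\<^sup>* (0, b) (0, b')"
    by blast
  \<comment> \<open>\<open>H a b\<close> and \<open>V a b\<close>: the contour crosses the left, respectively lower, side of the square \<open>(a, b)\<close>.\<close>
  define H where "H a b = (((a, b) \<in> C) \<noteq> ((a, b + 1) \<in> C))" for a b
  define V where "V a b = (((a, b) \<in> C) \<noteq> ((a + 1, b) \<in> C))" for a b
  define W where "W = {w. \<exists>b\<ge>0. H 0 b \<and> (contour_step C)\<^sup>*\<^sup>* (0, b) w}"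
  obtain K :: nat where K: "\<And>a b. (a, b) \<in> C \<Longrightarrow> \<bar>a\<bar> < int K \<and> \<bar>b\<bar> < int K"
  proof -
    define S where "S = insert 0 ((\<lambda>z. \<bar>fst z\<bar>) ` C \<union> (\<lambda>z. \<bar>snd z\<bar>) ` C)"
    have S: "finite S" using fin by (simp add: S_def)
    have "\<bar>a\<bar> < int (nat (Max S + 1)) \<and> \<bar>b\<bar> < int (nat (Max S + 1))" if "(a, b) \<in> C" for a b
    proof -
      have "\<bar>a\<bar> \<le> Max S" "\<bar>b\<bar> \<le> Max S"
        by (rule Max_ge[OF S]; use that in \<open>force simp: S_def\<close>)+
      then show ?thesis by linarith
    qed
    with that show thesis by blast
  qed
  define M where "M = int K + 1"
  have H0: "\<bar>a\<bar> < M \<and> \<bar>b\<bar> < M" if "H a b" for a b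
    using K[of a b] K[of a "b + 1"] that by (auto simp: H_def M_def)
  have V0: "\<bar>b\<bar> < M" if "V a b" for a b
    using K[of a b] K[of "a + 1" b] that by (auto simp: V_def M_def)
  have W_step: "v \<in> W \<longleftrightarrow> w \<in> W" if "contour_step C v w" for v w
  proof -
    have "v \<in> faces w"
      using that unfolding contour_step_def faces_def by (cases v; cases w) auto
    then have "contour_step C w v"
      using that by (simp add: contour_step_def Int_commute)
    with that show ?thesis unfolding W_def by (auto intro: rtranclp.rtrancl_into_rtrancl)
  qed
  have WH: "(a - 1, b) \<in> W \<longleftrightarrow> (a, b) \<in> W" if "H a b" for a b
    by (rule W_step[symmetric]) (use that in \<open>auto simp: contour_step_def corners_inter faces_def H_def\<close>)
  have WV: "(a, b - 1) \<in> W \<longleftrightarrow> (a, b) \<in> W" if "V a b" for a b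
    by (rule W_step[symmetric]) (use that in \<open>auto simp: contour_step_def corners_inter faces_def V_def\<close>)
  define g where "g a = (\<Sum>b\<in>{-M..M}. of_bool ((a, b) \<in> W \<and> H a b) :: int)" for a
  have g_step: "even (g a) \<longleftrightarrow> even (g (a + 1))" for a
  proof -
    define F where "F b = (of_bool ((a, b) \<in> W \<and> V a b) :: int)" for b
    \<comment> \<open>The contour crosses an even number of the sides of a square in \<open>W\<close>; outside \<open>W\<close> all terms are 0.\<close>
    have "even (of_bool ((a, b) \<in> W \<and> H a b) + of_bool ((a + 1, b) \<in> W \<and> H (a + 1) b)
        + (F b + F (b + 1)))" for b
    proof -
      have right: "(a + 1, b) \<in> W \<and> H (a + 1) b \<longleftrightarrow> (a, b) \<in> W \<and> H (a + 1) b"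
        using WH[of "a + 1" b] by auto
      have top: "(a, b + 1) \<in> W \<and> V a (b + 1) \<longleftrightarrow> (a, b) \<in> W \<and> V a (b + 1)"
        using WV[of a "b + 1"] by auto
      have "even (of_bool (H a b) + of_bool (H (a + 1) b) + (of_bool (V a b) + of_bool (V a (b + 1))) :: int)"
        unfolding H_def V_def by (simp add: of_bool_def)
      then show ?thesis unfolding F_def right top by (cases "(a, b) \<in> W") simp_all
    qed
    then have "even (\<Sum>b\<in>{-M..M}. of_bool ((a, b) \<in> W \<and> H a b) + of_bool ((a + 1, b) \<in> W \<and> H (a + 1) b)
        + (F b + F (b + 1)))"
      by (intro dvd_sum) blast
    moreover have "(\<Sum>b\<in>{-M..M}. F (b + 1)) = (\<Sum>b\<in>{-M..M}. F b)"
      by (rule sum_shift_int) (use V0 in \<open>auto simp: F_def split: if_splits\<close>)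
    ultimately show ?thesis by (simp add: sum.distrib g_def)
  qed
  have "even (g 0) \<longleftrightarrow> even (g (int n))" for n
  proof (induct n)
    case (Suc n)
    then show ?case using g_step[of "int n"] by (simp only: of_nat_Suc add.commute)
  qed simp
  moreover have "g (int (Suc K)) = 0"
    unfolding g_def by (rule sum.neutral) (use H0 in \<open>force simp: M_def\<close>)
  ultimately have "even (g 0)" by (metis even_zero)
  moreover have "g 0 = (\<Sum>b\<in>{0..int K}. of_bool (H 0 b))"
    unfolding g_def
  proof (rule sum.mono_neutral_cong_right)
    show "\<forall>b\<in>{-M..M} - {0..int K}. of_bool ((0, b) \<in> W \<and> H 0 b) = (0 :: int)"
    proof
      fix b assume "b \<in> {-M..M} - {0..int K}"
      then have "b < 0 \<or> b \<ge> M" by (auto simp: M_def)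
      moreover have "(0, b) \<notin> W" if "b < 0" using no_path that by (auto simp: W_def)
      ultimately show "of_bool ((0, b) \<in> W \<and> H 0 b) = (0 :: int)" using H0[of 0 b] by auto
    qed
    show "of_bool ((0, b) \<in> W \<and> H 0 b) = (of_bool (H 0 b) :: int)" if "b \<in> {0..int K}" for b
      using that by (auto simp: W_def)
  qed (auto simp: M_def)
  moreover have "even (\<Sum>b\<in>{0..int K}. of_bool (H 0 b) :: int) \<longleftrightarrow> ((0, 0) \<in> C \<longleftrightarrow> (0, int K + 1) \<in> C)"
    unfolding H_def by (rule even_sum_changes)
  ultimately show False using origin K[of 0 "int K + 1"] by auto
qed

section \<open>A weighted Peierls argument\<close>

text \<open>
  The edge crossed by the dual edge \<open>e\<close>, for the square lattice embedded by \<open>\<phi>\<close> in another graph.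
\<close>

definition crossing :: "(int \<times> int \<Rightarrow> 'v) \<Rightarrow> (int \<times> int) set \<Rightarrow> 'v set" where
  "crossing \<phi> e = \<phi> ` (\<Inter>v\<in>e. corners v)"

lemma crossing_cases:
  assumes "w \<in> faces v"
  obtains (hor) a b where "{v, w} = {(a, b), (a + 1, b)}" "snd v = snd w"
      "crossing \<phi> {v, w} = {\<phi> (a + 1, b), \<phi> (a + 1, b + 1)}"
    | (ver) a b where "{v, w} = {(a, b), (a, b + 1)}" "snd v \<noteq> snd w"
      "crossing \<phi> {v, w} = {\<phi> (a, b + 1), \<phi> (a + 1, b + 1)}"
proof -
  obtain a b where v: "v = (a, b)" by fastforce
  from assms consider "w = (a + 1, b)" | "w = (a - 1, b)" | "w = (a, b + 1)" | "w = (a, b - 1)"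
    by (auto simp: faces_def v)
  then show thesis
  proof cases
    case 1
    show thesis by (rule hor[of a b]) (auto simp: 1 v crossing_def corners_inter)
  next
    case 2
    show thesis by (rule hor[of "a - 1" b]) (auto simp: 2 v crossing_def corners_inter)
  next
    case 3
    show thesis by (rule ver[of a b]) (auto simp: 3 v crossing_def corners_inter)
  next
    case 4
    show thesis by (rule ver[of a "b - 1"]) (auto simp: 4 v crossing_def corners_inter)
  qed
qed

lemma inj_on_crossing:
  assumes "inj \<phi>"
  shows "inj_on (crossing \<phi>) {{v, w} |v w. w \<in> faces v}"
proof (rule inj_onI, clarify)
  fix v w v' w'
  assume vw: "w \<in> faces v" "w' \<in> faces v'" and eq: "crossing \<phi> {v, w} = crossing \<phi> {v', w'}"
  note [simp] = inj_eq[OF assms]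
  show "{v, w} = {v', w'}"
  proof (cases rule: crossing_cases[OF vw(1), where \<phi> = \<phi>, case_names hor ver])
    case (hor a b)
    note vw_eq = hor(1,3)
    show ?thesis
    proof (cases rule: crossing_cases[OF vw(2), where \<phi> = \<phi>, case_names hor ver])
      case (hor c d)
      have "{\<phi> (a + 1, b), \<phi> (a + 1, b + 1)} = {\<phi> (c + 1, d), \<phi> (c + 1, d + 1)}"
        using eq unfolding vw_eq(2) hor(3) .
      then have "a = c \<and> b = d" by (auto simp: doubleton_eq_iff)
      then show ?thesis using vw_eq(1) hor(1) by simp
    next
      case (ver c d)
      have "{\<phi> (a + 1, b), \<phi> (a + 1, b + 1)} = {\<phi> (c, d + 1), \<phi> (c + 1, d + 1)}"
        using eq unfolding vw_eq(2) ver(3) .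
      then show ?thesis by (auto simp: doubleton_eq_iff)
    qed
  next
    case (ver a b)
    note vw_eq = ver(1,3)
    show ?thesis
    proof (cases rule: crossing_cases[OF vw(2), where \<phi> = \<phi>, case_names hor ver])
      case (hor c d)
      have "{\<phi> (a, b + 1), \<phi> (a + 1, b + 1)} = {\<phi> (c + 1, d), \<phi> (c + 1, d + 1)}"
        using eq unfolding vw_eq(2) hor(3) .
      then show ?thesis by (auto simp: doubleton_eq_iff)
    next
      case (ver c d)
      have "{\<phi> (a, b + 1), \<phi> (a + 1, b + 1)} = {\<phi> (c, d + 1), \<phi> (c + 1, d + 1)}"
        using eq unfolding vw_eq(2) ver(3) .
      then have "a = c \<and> b = d" by (auto simp: doubleton_eq_iff)
      then show ?thesis using vw_eq(1) ver(1) by simp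
    qed
  qed
qed

text \<open>
  Peierls' argument with unequal weights. If the cluster of the origin is finite, a dual path of closed
  edges runs from some height \<open>b \<ge> 0\<close> on the vertical axis to a negative height; it has at least
  \<open>b + 1\<close> vertical steps. A vertical step crosses a horizontal edge, has two directions and
  costs \<open>1 - p\<close> each. A horizontal run of length \<open>k\<close> costs \<open>(1 - q)\<^sup>k\<close>, and since a self-avoiding
  path does not turn back, the runs between two vertical steps contribute
  \<open>1 + 2 (1 - q) / q = (2 - q) / q\<close> in total. So \<open>m\<close> vertical steps cost at most \<open>\<rho>\<^sup>m\<close>
  with \<open>\<rho> = 2 (1 - p) (2 - q) / q\<close>, and the sum over \<open>b\<close> is \<open>\<rho> / (1 - \<rho>) < 1\<close>. So it is
  the ratio of \<open>1 - p\<close> to \<open>q\<close> that has to be small.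
\<close>

lemma planar_percolation:
  fixes E :: "'v::countable set set" and \<phi> :: "int \<times> int \<Rightarrow> 'v"
  assumes inj: "inj \<phi>"
    and hor: "\<And>a b. {\<phi> (a, b), \<phi> (a + 1, b)} \<in> E" "\<And>a b. r {\<phi> (a, b), \<phi> (a + 1, b)} = p"
    and ver: "\<And>a b. {\<phi> (a, b), \<phi> (a, b + 1)} \<in> E" "\<And>a b. r {\<phi> (a, b), \<phi> (a, b + 1)} = q"
    and p: "0 \<le> p" "p \<le> 1" and q: "0 < q" "q \<le> 1"
    and small: "2 * (1 - p) / q * (2 - q) < 1 / 2"
  shows "measure (bond_percolation E r)
    {\<omega> \<in> space (bond_percolation E r). infinite (open_cluster E \<omega> (\<phi> (0, 0)))} > 0"
proof -
  let ?M = "bond_percolation E r"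
  interpret prob_space ?M by (rule prob_space_bond_percolation)
  define \<tau> where "\<tau> = 2 * (1 - p) / q"
  define \<rho> where "\<rho> = \<tau> * (2 - q)"
  have \<tau>: "0 \<le> \<tau>" using p q by (simp add: \<tau>_def)
  have \<rho>: "0 \<le> \<rho>" "\<rho> < 1 / 2"
    using \<tau> q small unfolding \<rho>_def by (simp, simp add: \<tau>_def)
  define c where "c v w = (of_bool (snd v \<noteq> snd w) :: nat)" for v w :: "int \<times> int"
  \<comment> \<open>In the middle of a horizontal run only one horizontal direction is left; this state has the
    weight \<open>\<tau> = 2 (1 - p) \<Sum> (1 - q)\<^sup>k\<close> in place of \<open>\<rho>\<close> for the next vertical step.\<close>
  define f where "f u v m = (if m = 0 then 1
      else if u = (fst v + 1, snd v) \<or> u = (fst v - 1, snd v) then \<tau> * \<rho> ^ (m - 1) else \<rho> ^ m)"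
    for u v :: "int \<times> int" and m :: nat
  define good where "good e \<omega> = (\<not> \<omega> (crossing \<phi> e))" for e and \<omega> :: "'v set \<Rightarrow> bool"
  let ?wt = "\<lambda>e. 1 - r (crossing \<phi> e)"
  have cross: "crossing \<phi> {v, w} \<in> E" "r (crossing \<phi> {v, w}) = (if snd v = snd w then q else p)"
    if "w \<in> faces v" for v w
    by (cases rule: crossing_cases[OF that, where \<phi> = \<phi>]; simp add: hor ver)+
  have meas: "Measurable.pred ?M (good {v, w})" if "w \<in> faces v" for v w
    unfolding good_def using measurable_edge_state[OF cross(1)[OF that]] by measurable
  have bound: "prob {\<omega> \<in> space ?M. \<exists>n. trail faces c (\<lambda>e. good e \<omega>) n {} u v m} \<le> f u v m" for u v m
  proof (rule prob_trail_le[where wt = ?wt and f = f])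
    show "prob {\<omega> \<in> space ?M. \<forall>e\<in>A. good e \<omega>} = (\<Prod>e\<in>A. ?wt e)"
      if A: "finite A" "A \<subseteq> {{v, w} |v w. w \<in> faces v}" for A
    proof -
      have sub: "crossing \<phi> ` A \<subseteq> E" using A(2) cross(1) by blast
      have r: "0 \<le> r e \<and> r e \<le> 1" if e: "e \<in> crossing \<phi> ` A" for e
      proof -
        obtain v w where "w \<in> faces v" "e = crossing \<phi> {v, w}"
          using e A(2) by blast
        then show ?thesis using cross(2) p q by simp
      qed
      have "prob {\<omega> \<in> space ?M. \<forall>e\<in>crossing \<phi> ` A. \<omega> e = False} = (\<Prod>e\<in>crossing \<phi> ` A. 1 - r e)"
        using prob_cylinder[of "crossing \<phi> ` A" E r "\<lambda>_. False"] A(1) sub r by simp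
      also have "\<dots> = (\<Prod>e\<in>A. ?wt e)"
        using inj_on_subset[OF inj_on_crossing[OF inj] A(2)] by (simp add: prod.reindex)
      finally show ?thesis by (simp add: good_def)
    qed
    show "0 \<le> f u v m" for u v m using \<tau> \<rho> by (simp add: f_def)
    show "1 \<le> f u v 0" for u v by (simp add: f_def)
    show "(\<Sum>w\<in>faces v - {u}. ?wt {v, w} * f v w (Suc m - c v w)) \<le> f u v (Suc m)" for u v m
    proof -
      obtain a b where v: "v = (a, b)" by fastforce
      let ?F = "\<lambda>w. ?wt {v, w} * f v w (Suc m - c v w)"
      have F: "?F (a + 1, b) = (1 - q) * (\<tau> * \<rho> ^ m)" "?F (a - 1, b) = (1 - q) * (\<tau> * \<rho> ^ m)"
        "?F (a, b + 1) = (1 - p) * \<rho> ^ m" "?F (a, b - 1) = (1 - p) * \<rho> ^ m"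
        using cross(2)[of "(a + 1, b)" v] cross(2)[of "(a - 1, b)" v]
          cross(2)[of "(a, b + 1)" v] cross(2)[of "(a, b - 1)" v]
        by (simp_all add: v faces_def c_def f_def)
      have two: "2 * (1 - p) * \<rho> ^ m = q * (\<tau> * \<rho> ^ m)" using q by (simp add: \<tau>_def)
      have faces: "faces v = {(a + 1, b), (a - 1, b), (a, b + 1), (a, b - 1)}" by (simp add: v faces_def)
      show ?thesis
      proof (cases "u = (a + 1, b) \<or> u = (a - 1, b)")
        case True
        then have "sum ?F (faces v - {u}) = (1 - q) * (\<tau> * \<rho> ^ m) + 2 * (1 - p) * \<rho> ^ m"
          unfolding faces using F by (auto simp: insert_Diff_if)
        also have "\<dots> = \<tau> * \<rho> ^ m" unfolding two by (simp add: algebra_simps)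
        finally show ?thesis using True by (simp add: f_def v)
      next
        case False
        have "0 \<le> ?F w" if "w \<in> faces v" for w
          using that F \<tau> \<rho> p q unfolding faces by auto
        then have "sum ?F (faces v - {u}) \<le> sum ?F (faces v)"
          by (intro sum_mono2) (auto simp: faces)
        also have "\<dots> = 2 * (1 - q) * (\<tau> * \<rho> ^ m) + 2 * (1 - p) * \<rho> ^ m"
          unfolding faces using F by (simp add: algebra_simps)
        also have "\<dots> = \<rho> ^ Suc m" unfolding two by (simp add: \<rho>_def algebra_simps)
        finally show ?thesis using False by (simp add: f_def v)
      qed
    qed
    show "0 \<le> ?wt {v, w}" if "w \<in> faces v" for v w using cross(2)[OF that] p q by simp
  qed (use meas in \<open>auto simp: faces_def\<close>)
  let ?T = "\<lambda>b \<omega>. \<exists>n. trail faces c (\<lambda>e. good e \<omega>) n {} (0, int b) (0, int b) (Suc b)"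
  let ?fin = "{\<omega> \<in> space ?M. finite (open_cluster E \<omega> (\<phi> (0, 0)))}"
  have T: "{\<omega> \<in> space ?M. ?T b \<omega>} \<in> events" for b
  proof -
    have "Measurable.pred ?M (?T b)"
      by (intro pred_intros_countable measurable_trail meas) (auto simp: faces_def)
    then show ?thesis by measurable
  qed
  have cover: "?fin \<subseteq> (\<Union>b. {\<omega> \<in> space ?M. ?T b \<omega>})"
  proof
    fix \<omega> assume \<omega>: "\<omega> \<in> ?fin"
    let ?X = "{e \<in> E. \<omega> e}"
    define C where "C = {z. linked ?X (\<phi> (0, 0)) (\<phi> z)}"
    have "finite (\<phi> -` open_cluster E \<omega> (\<phi> (0, 0)))"
      using \<omega> inj by (intro finite_vimageI) auto
    then have "finite C" by (simp add: C_def open_cluster_eq vimage_def)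
    moreover have "(0, 0) \<in> C" by (simp add: C_def)
    ultimately obtain b b' where b: "b \<ge> 0" "b' < 0" "(contour_step C)\<^sup>*\<^sup>* (0, b) (0, b')"
      by (rule contour_surrounds)
    then obtain xs where xs: "rtrancl_path (contour_step C) (0, b) xs (0, b')" "distinct ((0, b) # xs)"
      unfolding rtranclp_eq_rtrancl_path by (meson rtrancl_path_distinct)
    from xs have "trail faces c (\<lambda>e. good e \<omega>) (length xs) {} (0, b) (0, b) (Suc (nat b))"
    proof (rule trail_of_path[where h = snd])
      fix v w assume vw: "contour_step C v w"
      then have w: "w \<in> faces v" by (simp add: contour_step_def)
      obtain z z' where z: "crossing \<phi> {v, w} = {\<phi> z, \<phi> z'}" "z \<in> C" "z' \<notin> C"
      proof -
        obtain x y where xy: "corners v \<inter> corners w = {x, y}"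
          using w corners_inter by (cases v) (auto simp: faces_def)
        then have "x \<in> C \<and> y \<notin> C \<or> y \<in> C \<and> x \<notin> C"
          using vw by (auto simp: contour_step_def)
        with xy that[of x y] that[of y x] show thesis by (auto simp: crossing_def)
      qed
      have "\<not> \<omega> {\<phi> z, \<phi> z'}"
      proof
        assume "\<omega> {\<phi> z, \<phi> z'}"
        then have "linked ?X (\<phi> z) (\<phi> z')" using cross(1)[OF w] z(1) by (intro linked_edge) simp
        then show False using z by (auto simp: C_def intro: linked_trans)
      qed
      with z w show "w \<in> faces v \<and> good {v, w} \<omega>" by (simp add: good_def)
      show "snd v - snd w \<le> int (c v w)" using w by (auto simp: faces_def c_def)
    qed (use b xs in auto)
    then have "?T (nat b) \<omega>" using b by auto
    then show "\<omega> \<in> (\<Union>b. {\<omega> \<in> space ?M. ?T b \<omega>})" using \<omega> by blast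
  qed
  have Tle: "prob {\<omega> \<in> space ?M. ?T b \<omega>} \<le> \<rho> ^ Suc b" for b
    using bound[of "(0, int b)" "(0, int b)" "Suc b"] by (simp add: f_def)
  have "(\<lambda>b. \<rho> * \<rho> ^ b) sums (\<rho> * (1 / (1 - \<rho>)))"
    using \<rho> by (intro sums_mult geometric_sums) simp
  then have sums: "(\<lambda>b. \<rho> ^ Suc b) sums (\<rho> * (1 / (1 - \<rho>)))" by simp
  have summ: "summable (\<lambda>b. prob {\<omega> \<in> space ?M. ?T b \<omega>})"
    by (rule summable_comparison_test_ev[OF _ sums_summable[OF sums]]) (use Tle in auto)
  have "prob ?fin \<le> prob (\<Union>b. {\<omega> \<in> space ?M. ?T b \<omega>})"
    by (rule finite_measure_mono[OF cover]) (use T in auto)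
  also have "\<dots> \<le> (\<Sum>b. prob {\<omega> \<in> space ?M. ?T b \<omega>})"
    by (rule finite_measure_subadditive_countably) (use T summ in auto)
  also have "\<dots> \<le> (\<Sum>b. \<rho> ^ Suc b)"
    by (rule suminf_le[OF Tle summ sums_summable[OF sums]])
  also have "\<dots> = \<rho> * (1 / (1 - \<rho>))" using sums by (rule sums_unique[symmetric])
  also have "\<dots> < 1" using \<rho> by (simp add: field_simps)
  finally have "prob ?fin < 1" .
  moreover have "Measurable.pred ?M (\<lambda>\<omega>. infinite (open_cluster E \<omega> (\<phi> (0, 0))))"
    unfolding open_cluster_eq by (intro measurable_infinite_cluster measurable_open_edges)
  then have ev: "{\<omega> \<in> space ?M. infinite (open_cluster E \<omega> (\<phi> (0, 0)))} \<in> events" by measurable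
  have "?fin = space ?M - {\<omega> \<in> space ?M. infinite (open_cluster E \<omega> (\<phi> (0, 0)))}" by auto
  then have "prob ?fin = 1 - prob {\<omega> \<in> space ?M. infinite (open_cluster E \<omega> (\<phi> (0, 0)))}"
    using prob_compl[OF ev] by simp
  ultimately show ?thesis by simp
qed

section \<open>Exploring the slab along the projected cluster\<close>

text \<open>
  The part of the product graph that the exploration uses: copies of the edges in \<open>F\<close> on the levels
  \<open>0, \<dots>, K\<close> along a path \<open>lev\<close> in the second factor, and the rungs between consecutive levels
  over the vertices in \<open>V\<close>.
\<close>

definition slab :: "(nat \<Rightarrow> 'w) \<Rightarrow> 'v set set \<Rightarrow> 'v set \<Rightarrow> nat \<Rightarrow> ('v \<times> 'w) set set" where
  "slab lev F V K = (\<lambda>(e, k). e \<times> {lev k}) ` (F \<times> {..K}) \<union>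
     (\<lambda>(x, k). {x} \<times> {lev k, lev (Suc k)}) ` (V \<times> {..<K})"

text \<open>
  A copy of an edge is open with probability \<open>p\<close>. A rung over \<open>x\<close> stands for independent parallel
  strands, one for each edge of \<open>F\<close> at \<open>x\<close>, each open with probability \<open>a\<close>; the rung is open if
  some strand is. The two kinds of edges are told apart by their number of levels.
\<close>

definition slab_param :: "real \<Rightarrow> real \<Rightarrow> 'v set set \<Rightarrow> ('v \<times> 'w) set \<Rightarrow> real" where
  "slab_param p a F e = (if card (snd ` e) = 1 then p else 1 - (1 - a) ^ card {f \<in> F. fst ` e \<subseteq> f})"

text \<open>
  Each vertex \<open>x\<close> of the explored set \<open>S\<close> has been reached on the level \<open>t x\<close>.
\<close>

definition reaches_over ::
    "(nat \<Rightarrow> 'w) \<Rightarrow> 'v set \<Rightarrow> ('v \<Rightarrow> nat) \<Rightarrow> 'v set \<Rightarrow> ('v \<times> 'w) set set \<Rightarrow> bool" where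
  "reaches_over lev S t Y X \<longleftrightarrow> (\<exists>x\<in>S. \<exists>y\<in>Y. \<exists>u. linked X (x, lev (t x)) (y, u))"

lemma reaches_over_mono:
  "X \<subseteq> X' \<Longrightarrow> reaches_over lev S t Y X \<Longrightarrow> reaches_over lev S t Y X'"
  unfolding reaches_over_def by (meson linked_mono)

lemma finite_slab: "finite F \<Longrightarrow> finite V \<Longrightarrow> finite (slab lev F V K)"
  by (simp add: slab_def)

lemma slab_param_bounds:
  assumes "0 \<le> p" "p \<le> 1" "0 \<le> a" "a \<le> 1"
  shows "0 \<le> slab_param p a F e \<and> slab_param p a F e \<le> 1"
  using assms by (auto simp: slab_param_def intro!: power_le_one)

lemma slab_param_mono:
  assumes "finite F" "F' \<subseteq> F" "0 \<le> a" "a \<le> 1"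
  shows "slab_param p a F' e \<le> slab_param p a F e"
proof -
  have "card {f \<in> F'. fst ` e \<subseteq> f} \<le> card {f \<in> F. fst ` e \<subseteq> f}"
    using assms by (intro card_mono) auto
  then show ?thesis using assms by (auto simp: slab_param_def intro!: power_decreasing)
qed

text \<open>
  Once the edge \<open>{x, y}\<close> is known to be open, it can be forgotten if \<open>y\<close> joins the explored set:
  restart the path after its last use of the edge.
\<close>

lemma linked_insert_edge:
  assumes "linked (insert {x, y} X) z w" "z \<in> S" "x \<in> S"
  shows "\<exists>z'\<in>insert y S. linked X z' w"
  using assms(1) unfolding linked_def[of "insert {x, y} X"]
proof (induct rule: rtranclp_induct)
  case base
  then show ?case using assms(2) by (intro bexI[of _ z]) auto
next
  case (step w w')
  show ?case
  proof (cases "{w, w'} = {x, y}")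
    case True
    then have "w' \<in> insert y S" using assms(3) by (auto simp: doubleton_eq_iff)
    then show ?thesis by (intro bexI[of _ w']) auto
  next
    case False
    then have "linked X w w'" using step.hyps(2) by (intro linked_edge) simp
    then show ?thesis using step.hyps(3) by (blast intro: linked_trans)
  qed
qed

lemma linked_stays:
  assumes "linked X z w" "z \<in> S" "\<And>x y. {x, y} \<in> X \<Longrightarrow> x \<in> S \<Longrightarrow> y \<in> S"
  shows "w \<in> S"
  using assms(1) unfolding linked_def by (induct rule: rtranclp_induct) (auto intro: assms)

text \<open>
  The exploration step of the comparison, by induction on the set \<open>F\<close> of unexplored edges. Take an
  edge \<open>{x, y}\<close> of \<open>F\<close> that leaves \<open>S\<close>. On the left it is open with probability
  \<open>p + (1 - p) a p\<close>, and \<open>y\<close> joins \<open>S\<close>. On the right, try its copy on the level of \<open>x\<close>; if that is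
  closed, try the strand of the rung above \<open>x\<close> that is reserved for this edge, together with the copy
  one level higher. This succeeds with the same probability, with a level for \<open>y\<close> that depends on the
  outcome. All remaining copies of the edge can be discarded, and what is left is the slab over
  \<open>F - {{x, y}}\<close>, in which each rung has just the strands for the remaining edges. Reserving
  strands is what keeps the trials independent although the same rung may serve several edges at \<open>x\<close>.
\<close>

lemma exploration_comparison:
  fixes lev :: "nat \<Rightarrow> 'w" and V :: "'v set"
  assumes p: "0 \<le> p" "p \<le> 1" and a: "0 \<le> a" "a \<le> 1" and lev: "inj lev" and V: "finite V"
    and "finite F" "\<And>e. e \<in> F \<Longrightarrow> \<exists>x\<in>V. \<exists>y\<in>V. x \<noteq> y \<and> e = {x, y}"
    "\<And>x. x \<in> S \<Longrightarrow> t x + card F \<le> K"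
  shows "bernoulli_prob F (\<lambda>_. p + (1 - p) * a * p) (\<lambda>X. \<exists>x\<in>S. \<exists>y\<in>Y. linked X x y)
    \<le> bernoulli_prob (slab lev F V K) (slab_param p a F) (reaches_over lev S t Y)"
  using assms(7-9)
proof (induct "card F" arbitrary: F S t rule: less_induct)
  case less
  let ?p = "p + (1 - p) * a * p"
  let ?A = "\<lambda>S X. \<exists>x\<in>S. \<exists>y\<in>Y. linked X x y"
  note bounds = slab_param_bounds[OF p a]
  have pa: "0 \<le> ?p" "?p \<le> 1" "0 \<le> a * p" "a * p \<le> 1"
  proof -
    show ap: "0 \<le> a * p" "a * p \<le> 1" using p a by (auto intro: mult_le_one)
    then have "0 \<le> (1 - p) * (a * p)" "(1 - p) * (a * p) \<le> (1 - p) * 1"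
      using p by (auto intro!: mult_left_mono mult_nonneg_nonneg simp del: mult_1_right)
    then show "0 \<le> ?p" "?p \<le> 1" using p by (simp_all add: mult.assoc)
  qed
  have finI: "finite (slab lev F V K)" using less.prems(1) V by (rule finite_slab)
  consider (hit) "S \<inter> Y \<noteq> {}"
    | (stuck) "S \<inter> Y = {}" "\<And>x y. {x, y} \<in> F \<Longrightarrow> x \<in> S \<Longrightarrow> y \<in> S"
    | (explore) x y where "{x, y} \<in> F" "x \<in> S" "y \<notin> S"
    by blast
  then show ?case
  proof cases
    case hit
    then obtain z where "z \<in> S" "z \<in> Y" by blast
    then have "reaches_over lev S t Y X" for X
      unfolding reaches_over_def by (intro bexI[of _ z] exI[of _ "lev (t z)"]) simp_all
    then have "reaches_over lev S t Y = (\<lambda>_. True)" by blast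
    then have "bernoulli_prob (slab lev F V K) (slab_param p a F) (reaches_over lev S t Y) = 1"
      using bernoulli_prob_True[OF finI] by simp
    then show ?thesis using bernoulli_prob_le_1[OF less.prems(1)] pa by simp
  next
    case stuck
    have "\<not> ?A S X" if "X \<subseteq> F" for X
      using linked_stays[of X _ _ S] stuck that by blast
    then have "bernoulli_prob F (\<lambda>_. ?p) (?A S) = bernoulli_prob F (\<lambda>_. ?p) (\<lambda>_. False)"
      by (intro bernoulli_prob_cong) auto
    also have "\<dots> = 0" by (simp add: bernoulli_prob_def)
    finally show ?thesis using bernoulli_prob_nonneg bounds by metis
  next
    case explore
    define F' where "F' = F - {{x, y}}"
    have F: "F = insert {x, y} F'" "{x, y} \<notin> F'" "finite F'" and F'_sub: "F' \<subseteq> F"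
      using explore less.prems(1) by (auto simp: F'_def)
    have card: "card F = Suc (card F')" using F by simp
    obtain "x \<noteq> y" "x \<in> V" "y \<in> V"
      using less.prems(2)[OF explore(1)] by (auto simp: doubleton_eq_iff)
    let ?S = "insert y S"
    let ?I = "slab lev F' V K" and ?r = "slab_param p a F" and ?r' = "slab_param p a F'"
    let ?D = "reaches_over lev S t Y"
    let ?Dsame = "reaches_over lev ?S (t(y := t x)) Y" and ?Dnext = "reaches_over lev ?S (t(y := Suc (t x))) Y"
    define R0 where "R0 = bernoulli_prob ?I ?r' ?D"
    define R1 where "R1 = bernoulli_prob ?I ?r' ?Dsame"
    define R2 where "R2 = bernoulli_prob ?I ?r' ?Dnext"
    define L0 where "L0 = bernoulli_prob F' (\<lambda>_. ?p) (?A S)"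
    define L1 where "L1 = bernoulli_prob F' (\<lambda>_. ?p) (?A ?S)"
    have tx: "Suc (t x) \<le> K" using less.prems(3)[OF explore(2)] card by simp
    have IH: "bernoulli_prob F' (\<lambda>_. ?p) (?A S') \<le> bernoulli_prob ?I ?r' (reaches_over lev S' t' Y)"
      if "\<And>z. z \<in> S' \<Longrightarrow> t' z + card F' \<le> K" for S' t'
      by (rule less.hyps) (use that card F less.prems(2) F'_sub in auto)
    have L0: "L0 \<le> R0" unfolding L0_def R0_def
      by (rule IH) (use less.prems(3) card in fastforce)
    have L1: "L1 \<le> R1" "L1 \<le> R2" unfolding L1_def R1_def R2_def
      by (rule IH; use less.prems(3) card explore in fastforce)+
    have "bernoulli_prob F (\<lambda>_. ?p) (?A S)
        = ?p * bernoulli_prob F' (\<lambda>_. ?p) (\<lambda>X. ?A S (insert {x, y} X)) + (1 - ?p) * L0"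
      unfolding F(1) L0_def by (rule bernoulli_prob_insert[OF F(3,2)])
    also have "\<dots> \<le> ?p * L1 + (1 - ?p) * L0"
    proof -
      have "bernoulli_prob F' (\<lambda>_. ?p) (\<lambda>X. ?A S (insert {x, y} X)) \<le> L1"
        unfolding L1_def
        by (rule bernoulli_prob_mono_event) (use pa explore in \<open>auto dest: linked_insert_edge\<close>)
      then show ?thesis using pa by (intro add_right_mono mult_left_mono)
    qed
    finally have left: "bernoulli_prob F (\<lambda>_. ?p) (?A S) \<le> ?p * L1 + (1 - ?p) * L0" .

    \<comment> \<open>\<open>v\<close> is the rung above \<open>x\<close>, \<open>h k\<close> the copy of \<open>{x, y}\<close> on level \<open>k\<close>.\<close>
    define v where "v = {x} \<times> {lev (t x), lev (Suc (t x))}"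
    define h where "h k = {x, y} \<times> {lev k}" for k
    define J where "J = ?I - {v}"
    have lev_neq: "lev (t x) \<noteq> lev (Suc (t x))" using inj_eq[OF lev] by simp
    have vI: "v \<in> ?I"
      unfolding slab_def v_def
      by (rule UnI2, rule image_eqI[of _ _ "(x, t x)"]) (use tx \<open>x \<in> V\<close> in auto)
    have finJ: "finite J" "v \<notin> J" and I: "?I = insert v J"
      using finite_slab[OF F(3) V] vI by (auto simp: J_def)
    have h_notin: "h k \<notin> ?I" for k
    proof
      assume "h k \<in> ?I"
      then consider f j where "f \<in> F'" "h k = f \<times> {lev j}"
        | z j where "h k = {z} \<times> {lev j, lev (Suc j)}"
        by (auto simp: slab_def)
      then show False
      proof cases
        case 1
        then have "fst ` h k = f" by (simp add: fst_image_times)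
        moreover have "fst ` h k = {x, y}" by (simp add: h_def fst_image_times)
        ultimately show False using F(2) 1 by simp
      next
        case 2
        then have "fst ` h k = {z}" by (simp add: fst_image_times)
        moreover have "fst ` h k = {x, y}" by (simp add: h_def fst_image_times)
        ultimately show False using \<open>x \<noteq> y\<close> by auto
      qed
    qed
    have h_neq: "h (t x) \<noteq> h (Suc (t x))" using lev_neq by (auto simp: h_def)
    have sub: "insert (h (t x)) (insert (h (Suc (t x))) ?I) \<subseteq> slab lev F V K"
    proof -
      have "h k \<in> slab lev F V K" if "k \<le> K" for k
        unfolding slab_def h_def
        by (rule UnI1, rule image_eqI[of _ _ "({x, y}, k)"]) (use explore(1) that in auto)
      moreover have "?I \<subseteq> slab lev F V K" using F'_sub by (auto simp: slab_def)
      ultimately show ?thesis using tx by auto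
    qed
    have rh: "?r (h k) = p" for k by (simp add: slab_param_def h_def snd_image_times)
    \<comment> \<open>Split off the strand of the rung that is reserved for \<open>{x, y}\<close>.\<close>
    have rv: "?r v = a + (1 - a) * ?r' v"
    proof -
      have 1: "card (snd ` v) \<noteq> 1" using lev_neq by (simp add: v_def snd_image_times)
      have "{f \<in> F. fst ` v \<subseteq> f} = insert {x, y} {f \<in> F'. fst ` v \<subseteq> f}"
        by (auto simp: F(1) v_def fst_image_times)
      then have "card {f \<in> F. fst ` v \<subseteq> f} = Suc (card {f \<in> F'. fst ` v \<subseteq> f})"
        using F by simp
      then show ?thesis using 1 by (simp add: slab_param_def algebra_simps)
    qed
    have rr: "?r' e \<le> ?r e" for e by (rule slab_param_mono[OF less.prems(1) F'_sub a])
    have par: "0 \<le> ?r' e \<and> ?r' e \<le> ?r e \<and> ?r e \<le> 1" for e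
      using bounds[of F' e] bounds[of F e] rr[of e] by simp
    have up: "?D X \<Longrightarrow> ?D X'" if "X \<subseteq> X'" for X X' using that by (rule reaches_over_mono)
    have D0: "?D (insert (h (t x)) X)" if "?Dsame X" for X
    proof -
      from that obtain z w u where z: "z \<in> ?S" "w \<in> Y" "linked X (z, lev ((t(y := t x)) z)) (w, u)"
        unfolding reaches_over_def by blast
      let ?X = "insert (h (t x)) X"
      have X: "linked ?X (z, lev ((t(y := t x)) z)) (w, u)" using z(3) by (rule linked_mono) auto
      show ?thesis
      proof (cases "z = y")
        case True
        have "linked ?X (x, lev (t x)) (y, lev (t x))"
          by (rule linked_edge) (simp add: h_def insert_Times_insert)
        then have "linked ?X (x, lev (t x)) (w, u)" using X True by (auto intro: linked_trans)
        then show ?thesis using z explore by (auto simp: reaches_over_def)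
      next
        case False
        then show ?thesis using X z by (auto simp: reaches_over_def)
      qed
    qed
    have D1: "?D (insert v (insert (h (Suc (t x))) X))" if "?Dnext (insert v X)" for X
    proof -
      from that obtain z w u where
        z: "z \<in> ?S" "w \<in> Y" "linked (insert v X) (z, lev ((t(y := Suc (t x))) z)) (w, u)"
        unfolding reaches_over_def by blast
      let ?X = "insert v (insert (h (Suc (t x))) X)"
      have X: "linked ?X (z, lev ((t(y := Suc (t x))) z)) (w, u)" using z(3) by (rule linked_mono) auto
      show ?thesis
      proof (cases "z = y")
        case True
        have "linked ?X (x, lev (t x)) (x, lev (Suc (t x)))"
          by (rule linked_edge) (simp add: v_def insert_Times_insert)
        moreover have "linked ?X (x, lev (Suc (t x))) (y, lev (Suc (t x)))"
          by (rule linked_edge) (simp add: h_def insert_Times_insert)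
        ultimately have "linked ?X (x, lev (t x)) (w, u)" using X True by (auto intro: linked_trans)
        then show ?thesis using z explore by (auto simp: reaches_over_def)
      next
        case False
        then show ?thesis using X z by (auto simp: reaches_over_def)
      qed
    qed
    have D_D1: "?Dnext X" if "?D X" for X
    proof -
      from that obtain z w u where z: "z \<in> S" "w \<in> Y" "linked X (z, lev (t z)) (w, u)"
        unfolding reaches_over_def by blast
      then have "z \<noteq> y" using explore(3) by auto
      then show ?thesis unfolding reaches_over_def using z by (intro bexI[of _ z] bexI[of _ w] exI[of _ u]) auto
    qed
    have finI': "finite ?I" using finite_slab[OF F(3) V] .
    \<comment> \<open>Conditional probabilities given the state of the rung \<open>v\<close>: open for \<open>a\<close>, closed for \<open>b\<close>;
      index 0 if \<open>y\<close> is not reached, index 1 if it is reached on the next level.\<close>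
    define a0 where "a0 = bernoulli_prob J ?r' (\<lambda>X. ?D (insert v X))"
    define a1 where "a1 = bernoulli_prob J ?r' (\<lambda>X. ?Dnext (insert v X))"
    define b0 where "b0 = bernoulli_prob J ?r' ?D"
    define b1 where "b1 = bernoulli_prob J ?r' ?Dnext"
    have R0: "R0 = ?r' v * a0 + (1 - ?r' v) * b0"
      unfolding R0_def I a0_def b0_def by (rule bernoulli_prob_insert[OF finJ])
    have R2: "R2 = ?r' v * a1 + (1 - ?r' v) * b1"
      unfolding R2_def I a1_def b1_def by (rule bernoulli_prob_insert[OF finJ])
    have b0a0: "b0 \<le> a0" unfolding a0_def b0_def
      by (rule bernoulli_prob_mono_event[OF bounds]) (erule up[OF subset_insertI])
    have b1a1: "b1 \<le> a1" unfolding a1_def b1_def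
      by (rule bernoulli_prob_mono_event[OF bounds]) (erule reaches_over_mono[OF subset_insertI])
    have a0a1: "a0 \<le> a1" unfolding a0_def a1_def
      by (rule bernoulli_prob_mono_event[OF bounds]) (rule D_D1)

    let ?G = "insert (h (Suc (t x))) ?I"
    have finG: "finite ?G" using finI' by simp
    have R1_le: "R1 \<le> bernoulli_prob ?G ?r (\<lambda>X. ?D (insert (h (t x)) X))"
    proof -
      have "R1 \<le> bernoulli_prob ?I ?r ?Dsame"
        unfolding R1_def by (rule bernoulli_prob_mono_param[OF finI' par reaches_over_mono])
      also have "\<dots> \<le> bernoulli_prob ?G ?r ?Dsame"
        by (rule bernoulli_prob_mono_index[OF finG subset_insertI bounds reaches_over_mono])
      also have "\<dots> \<le> bernoulli_prob ?G ?r (\<lambda>X. ?D (insert (h (t x)) X))"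
        by (rule bernoulli_prob_mono_event[OF bounds]) (rule D0)
      finally show ?thesis .
    qed
    have J_mono: "bernoulli_prob J ?r' A \<le> bernoulli_prob J ?r A"
      if "\<And>X Y. X \<subseteq> Y \<Longrightarrow> A X \<Longrightarrow> A Y" for A
      by (rule bernoulli_prob_mono_param[OF finJ(1) par that])
    let ?H = "insert (h (Suc (t x))) J"
    have "v \<noteq> h k" for k using vI h_notin by metis
    then have H: "h (Suc (t x)) \<notin> J" "finite ?H" "v \<notin> ?H"
      using h_notin finJ by (simp_all add: J_def)
    have G: "?G = insert v ?H" unfolding I by (rule insert_commute)
    have b0_le: "b0 \<le> bernoulli_prob ?H ?r ?D"
    proof -
      have "b0 \<le> bernoulli_prob J ?r ?D" unfolding b0_def by (rule J_mono) (rule up)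
      also have "\<dots> \<le> bernoulli_prob ?H ?r ?D"
        by (rule bernoulli_prob_mono_index[OF H(2) subset_insertI bounds reaches_over_mono])
      finally show ?thesis .
    qed
    have a_le: "p * a1 + (1 - p) * a0 \<le> bernoulli_prob ?H ?r (\<lambda>X. ?D (insert v X))"
    proof -
      have "a1 \<le> bernoulli_prob J ?r (\<lambda>X. ?Dnext (insert v X))"
        unfolding a1_def by (rule J_mono) (erule reaches_over_mono[OF Set.insert_mono])
      also have "\<dots> \<le> bernoulli_prob J ?r (\<lambda>X. ?D (insert v (insert (h (Suc (t x))) X)))"
        by (rule bernoulli_prob_mono_event[OF bounds]) (rule D1)
      finally have 1: "a1 \<le> bernoulli_prob J ?r (\<lambda>X. ?D (insert v (insert (h (Suc (t x))) X)))" .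
      have 0: "a0 \<le> bernoulli_prob J ?r (\<lambda>X. ?D (insert v X))"
        unfolding a0_def by (rule J_mono) (erule up[OF Set.insert_mono])
      show ?thesis
        unfolding bernoulli_prob_insert[OF finJ(1) H(1)] rh
        using 0 1 p by (intro add_mono mult_left_mono) auto
    qed
    \<comment> \<open>The copy of \<open>{x, y}\<close> on the level of \<open>x\<close> is closed.\<close>
    have G_ge: "a * p * R2 + (1 - a * p) * R0 \<le> bernoulli_prob ?G ?r ?D"
    proof -
      let ?s = "?r' v"
      have s: "0 \<le> ?s" "?s \<le> 1" using bounds by auto
      let ?m = "p * a1 + (1 - p) * a0"
      have R2_le: "R2 \<le> a1"
        using R2 mult_left_mono[OF b1a1, of "1 - ?s"] s by (simp add: algebra_simps)
      have R0_le: "R0 \<le> a0"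
        using R0 mult_left_mono[OF b0a0, of "1 - ?s"] s by (simp add: algebra_simps)
      have a0m: "a0 \<le> ?m" using mult_left_mono[OF a0a1, of p] p by (simp add: algebra_simps)
      \<comment> \<open>Condition on the reserved strand. If it is open, so is the rung, which is at least as good as
        a rung with the remaining strands only, and the copy on the next level decides. If it is closed,
        the rung is left with the remaining strands, as in \<open>R0\<close>.\<close>
      have "a * p * R2 + (1 - a * p) * R0 = a * (p * R2 + (1 - p) * R0) + (1 - a) * R0"
        by (simp add: algebra_simps)
      also have "\<dots> \<le> a * ?m + (1 - a) * (?s * ?m + (1 - ?s) * b0)"
        unfolding R0 
        by (intro add_mono mult_left_mono order.refl R2_le R0_le[unfolded R0] a0m) (use p a s in auto)
      also have "\<dots> = ?r v * ?m + (1 - ?r v) * b0" unfolding rv by (simp add: algebra_simps)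
      also have "\<dots> \<le> bernoulli_prob ?G ?r ?D"
        unfolding G bernoulli_prob_insert[OF H(2,3)]
        using a_le b0_le bounds[of F v] by (intro add_mono mult_left_mono) auto
      finally show ?thesis .
    qed
    have "?p * L1 + (1 - ?p) * L0 = p * L1 + (1 - p) * (a * p * L1 + (1 - a * p) * L0)"
      by (simp add: algebra_simps)
    also have "\<dots> \<le> p * R1 + (1 - p) * (a * p * R2 + (1 - a * p) * R0)"
      using L0 L1 p pa by (intro add_mono mult_left_mono) auto
    also have "\<dots> \<le> p * bernoulli_prob ?G ?r (\<lambda>X. ?D (insert (h (t x)) X)) + (1 - p) * bernoulli_prob ?G ?r ?D"
      using R1_le G_ge p by (intro add_mono mult_left_mono) auto
    also have "\<dots> = bernoulli_prob (insert (h (t x)) ?G) ?r ?D"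
      using bernoulli_prob_insert[of ?G "h (t x)" ?r ?D] finG h_notin h_neq rh by simp
    also have "\<dots> \<le> bernoulli_prob (slab lev F V K) ?r ?D"
      by (rule bernoulli_prob_mono_index[OF finI sub bounds reaches_over_mono])
    finally show ?thesis using left by simp
  qed
qed

section \<open>The critical threshold is at most 5 / 6 from dimension two on\<close>

lemma critical_threshold_leI:
  assumes "\<And>p. \<lbrakk>0 \<le> p; p \<le> 1;
      \<P>(\<omega> in (homogeneous_percolation p :: ((int ^ 'd::finite) set \<Rightarrow> bool) measure).
        infinite (open_cluster lattice_edges \<omega> 0)) = 0\<rbrakk> \<Longrightarrow> p \<le> c"
  shows "critical_threshold TYPE('d) \<le> c"
proof -
  let ?S = "{p \<in> {0..1}. \<P>(\<omega> in (homogeneous_percolation p :: ((int ^ 'd) set \<Rightarrow> bool) measure).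
        infinite (open_cluster lattice_edges \<omega> 0)) = 0}"
  have "real CARD('d) \<ge> 1" by (simp add: Suc_leI)
  then have "0 < 2 * real CARD('d) - 1" by linarith
  then have "0 \<in> ?S" using prob_infinite_cluster_eq_0[of 0] by simp
  then have "?S \<noteq> {}" by blast
  then show ?thesis
    unfolding critical_threshold_def by (rule cSup_least) (use assms in simp)
qed

lemma prob_infinite_cluster_pos:
  assumes "critical_threshold TYPE('d::finite) < p" "p \<le> 1"
  shows "0 < \<P>(\<omega> in (homogeneous_percolation p :: ((int ^ 'd) set \<Rightarrow> bool) measure).
    infinite (open_cluster lattice_edges \<omega> 0))" (is "0 < ?\<theta>")
proof -
  have "real CARD('d) \<ge> 1" by (simp add: Suc_leI)
  then have "0 < 2 * real CARD('d) - 1" by linarith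
  then have "0 < 1 / (2 * real CARD('d) - 1)" by (rule divide_pos_pos[OF zero_less_one])
  then have "p \<ge> 0" using critical_threshold_ge[where 'd = 'd] assms by linarith
  have "?\<theta> \<noteq> 0"
  proof
    assume "?\<theta> = 0"
    then have "p \<le> critical_threshold TYPE('d)"
      unfolding critical_threshold_def
      using assms \<open>p \<ge> 0\<close> by (intro cSup_upper) (auto intro!: bdd_aboveI[of _ 1])
    with assms show False by simp
  qed
  then show ?thesis by (simp add: zero_less_measure_iff)
qed

text \<open>
  A coordinate plane of \<open>\<int>\<^sup>d\<close> already percolates at \<open>p \<ge> 5 / 6\<close>, where Peierls' ratio
  \<open>2 (1 - p) (2 - p) / p\<close> is at most \<open>7 / 15\<close>. The bound leaves enough room for
  \<open>4 d p\<^sub>c (1 - p\<^sub>c) > 1\<close> when \<open>p\<^sub>c > 1 / 2\<close>.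
\<close>

lemma critical_threshold_le:
  assumes "CARD('d::finite) \<ge> 2"
  shows "critical_threshold TYPE('d) \<le> 5 / 6"
proof -
  let ?\<theta> = "\<lambda>p. \<P>(\<omega> in (homogeneous_percolation p :: ((int ^ 'd) set \<Rightarrow> bool) measure).
        infinite (open_cluster lattice_edges \<omega> 0))"
  have pos: "0 < ?\<theta> p" if p: "5 / 6 \<le> p" "p \<le> 1" for p
  proof -
    obtain i j :: 'd where ij: "i \<noteq> j"
      using assms by (metis card_1_singleton_iff card_2_iff' ex_card numeral_2_eq_2 top_greatest)
    define \<phi> :: "int \<times> int \<Rightarrow> int ^ 'd" where "\<phi> z = axis i (fst z) + axis j (snd z)" for z
    have nth: "\<phi> z $ i = fst z" "\<phi> z $ j = snd z" for z
      using ij by (simp_all add: \<phi>_def axis_def)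
    have "inj \<phi>" by (rule injI) (metis nth prod_eq_iff)
    have step: "\<phi> (a + 1, b) = \<phi> (a, b) + axis i 1" "\<phi> (a, b + 1) = \<phi> (a, b) + axis j 1" for a b
      by (auto simp: \<phi>_def vec_eq_iff axis_def)
    have small: "2 * (1 - p) / p * (2 - p) < 1 / 2"
    proof -
      have "(1 - p) * (2 - p) \<le> (1 / 6) * (7 / 6)" using p by (intro mult_mono) auto
      then have "2 * ((1 - p) * (2 - p)) < 1 / 2 * p" using p by linarith
      then have "2 * ((1 - p) * (2 - p)) / p < 1 / 2" using p by (simp add: pos_divide_less_eq)
      then show ?thesis by (simp only: times_divide_eq_left mult.assoc)
    qed
    have "measure (bond_percolation lattice_edges (\<lambda>_. p)) {\<omega> \<in> space (bond_percolation lattice_edges (\<lambda>_. p)).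
        infinite (open_cluster lattice_edges \<omega> (\<phi> (0, 0)))} > 0"
      by (rule planar_percolation[OF \<open>inj \<phi>\<close>, of _ _ p p])
         (use p small in \<open>simp_all add: step edge_in_lattice_edges\<close>)
    moreover have "\<phi> (0, 0) = 0" by (simp add: \<phi>_def vec_eq_iff axis_def)
    ultimately show ?thesis unfolding homogeneous_percolation_def by simp
  qed
  then show ?thesis by (intro critical_threshold_leI) force
qed

section \<open>Comparison of the product lattice with the base lattice\<close>

lemma prod_lattice_edges_fst: "l1_dist x y = 1 \<Longrightarrow> {(x, u), (y, u)} \<in> prod_lattice_edges"
  unfolding prod_lattice_edges_def by force

lemma prod_lattice_edges_snd: "l1_dist u v = 1 \<Longrightarrow> {(x, u), (x, v)} \<in> prod_lattice_edges"
  unfolding prod_lattice_edges_def by force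

lemma differ_only_in_fst_fst: "x \<noteq> y \<Longrightarrow> differ_only_in_fst {(x, u), (y, u)}"
  by (auto simp: differ_only_in_fst_def)

lemma differ_only_in_fst_snd: "\<not> differ_only_in_fst {(x, u), (x, v)}"
  by (auto simp: differ_only_in_fst_def doubleton_eq_iff)

lemma countable_prod_lattice_edges: "countable prod_lattice_edges"
  by (rule countable_subset[of _ "range (\<lambda>(z, z'). {z, z'})"]) (auto simp: prod_lattice_edges_def)

text \<open>
  The plane is spanned by one direction of each factor.
\<close>

lemma planar_anisotropic:
  assumes "0 \<le> p" "p \<le> 1" "0 < q" "q \<le> 1" "2 * (1 - p) / q * (2 - q) < 1 / 2"
  shows "0 < \<P>(\<omega> in (anisotropic_percolation p q :: (((int ^ 'd::finite) \<times> (int ^ 's::finite)) set \<Rightarrow> bool) measure).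
    infinite (open_cluster prod_lattice_edges \<omega> (0, 0)))"
proof -
  obtain i :: 'd and j :: 's where True by simp
  define \<phi> :: "int \<times> int \<Rightarrow> (int ^ 'd) \<times> (int ^ 's)" where "\<phi> z = (axis i (fst z), axis j (snd z))" for z
  have "inj \<phi>"
    by (rule injI) (auto simp: \<phi>_def axis_eq_axis prod_eq_iff)
  have step: "axis k (c + 1) = axis k c + axis k 1" for k :: "'n::finite" and c :: int
    by (auto simp: vec_eq_iff axis_def)
  have ne: "x \<noteq> x + axis k 1" for x :: "int ^ 'n::finite" and k
    by (metis l1_dist_add_axis(1) l1_dist_self abs_one zero_neq_one)
  let ?r = "\<lambda>e. if differ_only_in_fst e then p else q"
  have "measure (bond_percolation prod_lattice_edges ?r)
      {\<omega> \<in> space (bond_percolation prod_lattice_edges ?r). infinite (open_cluster prod_lattice_edges \<omega> (\<phi> (0, 0)))} > 0"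
    by (rule planar_percolation[OF \<open>inj \<phi>\<close>, of _ _ p q])
       (use assms in \<open>simp_all add: \<phi>_def step prod_lattice_edges_fst prod_lattice_edges_snd
          differ_only_in_fst_fst differ_only_in_fst_snd ne\<close>)
  moreover have "\<phi> (0, 0) = (0, 0)" by (simp add: \<phi>_def vec_eq_iff axis_def)
  ultimately show ?thesis unfolding anisotropic_percolation_def by simp
qed

lemma linked_first_exit:
  assumes "linked X x y" "x \<in> S" "y \<notin> S"
  shows "\<exists>w. w \<notin> S \<and> linked {e \<in> X. e \<inter> S \<noteq> {}} x w"
proof -
  have "(\<exists>w. w \<notin> S \<and> linked {e \<in> X. e \<inter> S \<noteq> {}} x w) \<or> y \<in> S \<and> linked {e \<in> X. e \<inter> S \<noteq> {}} x y"
    using assms(1) unfolding linked_def[of X]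
  proof (induct rule: rtranclp_induct)
    case base
    then show ?case using assms(2) by simp
  next
    case (step y z)
    show ?case
    proof (cases "y \<in> S \<and> linked {e \<in> X. e \<inter> S \<noteq> {}} x y")
      case True
      then have "linked {e \<in> X. e \<inter> S \<noteq> {}} y z" using step.hyps(2) by (intro linked_edge) auto
      then have "linked {e \<in> X. e \<inter> S \<noteq> {}} x z" using True by (blast intro: linked_trans)
      then show ?thesis by blast
    next
      case False
      then show ?thesis using step.hyps(3) by blast
    qed
  qed
  then show ?thesis using assms(3) by blast
qed

text \<open>
  The event that the cluster of the origin leaves a finite ball depends on finitely many edges only, so
  \<open>exploration_comparison\<close> applies to it, with \<open>a = q / (2 d)\<close>: a rung of at most \<open>2 d\<close> strands is
  open with probability at most \<open>1 - (1 - a)\<^sup>2\<^sup>d \<le> q\<close>, by Bernoulli's inequality. The cluster is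
  infinite if its projection leaves all balls.
\<close>

lemma anisotropic_dominates:
  assumes p: "0 \<le> p" "p \<le> 1" and q: "0 \<le> q" "q \<le> 1"
    and p': "p' = p + (1 - p) * (q / (2 * real CARD('d))) * p"
  shows "\<P>(\<omega> in (homogeneous_percolation p' :: ((int ^ 'd::finite) set \<Rightarrow> bool) measure).
        infinite (open_cluster lattice_edges \<omega> 0))
    \<le> \<P>(\<omega> in (anisotropic_percolation p q :: (((int ^ 'd) \<times> (int ^ 's::finite)) set \<Rightarrow> bool) measure).
        infinite (open_cluster prod_lattice_edges \<omega> (0, 0)))"
    (is "?\<theta> \<le> _")
proof -
  let ?N = "homogeneous_percolation p' :: ((int ^ 'd) set \<Rightarrow> bool) measure"
  let ?r = "\<lambda>e. if differ_only_in_fst e then p else q"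
  let ?M = "anisotropic_percolation p q :: (((int ^ 'd) \<times> (int ^ 's)) set \<Rightarrow> bool) measure"
  let ?E = "prod_lattice_edges :: ((int ^ 'd) \<times> (int ^ 's)) set set"
  interpret N: prob_space ?N
    unfolding homogeneous_percolation_def by (rule prob_space_bond_percolation)
  interpret prob_space ?M
    unfolding anisotropic_percolation_def by (rule prob_space_bond_percolation)
  have d: "real CARD('d) \<ge> 1" by (simp add: Suc_leI)
  define a where "a = q / (2 * real CARD('d))"
  have "q / (2 * real CARD('d)) \<le> 1 / 1" by (rule frac_le) (use q d in linarith)+
  then have a: "0 \<le> a" "a \<le> 1" using q by (simp_all add: a_def)
  have ap: "0 \<le> (1 - p) * a * p" "(1 - p) * a * p \<le> 1 - p"
  proof -
    have "a * p \<le> 1" using a p by (intro mult_le_one) auto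
    then show "0 \<le> (1 - p) * a * p" "(1 - p) * a * p \<le> 1 - p"
      using a p mult_left_mono[of "a * p" 1 "1 - p"] by (auto simp: mult.assoc)
  qed
  then have p'01: "0 \<le> p'" "p' \<le> 1" using p p' by (auto simp: a_def)
  obtain j :: 's where True by simp
  define lev :: "nat \<Rightarrow> int ^ 's" where "lev k = axis j (int k)" for k
  have lev: "inj lev" by (rule injI) (auto simp: lev_def axis_eq_axis)
  have lev_Suc: "lev (Suc k) = lev k + axis j 1" for k
    by (auto simp: lev_def vec_eq_iff axis_def)
  have lev0: "lev 0 = 0" by (simp add: lev_def vec_eq_iff axis_def)

  define B where "B n \<omega> \<longleftrightarrow> (\<exists>y u. l1_dist 0 y > int n \<and> linked {e \<in> ?E. \<omega> e} (0, 0) (y, u))" for n \<omega>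
  have measB: "Measurable.pred ?M (B n)" for n
  proof -
    have "Measurable.pred ?M (\<lambda>\<omega>. linked {e \<in> ?E. \<omega> e} (0, 0) z)" for z
      unfolding anisotropic_percolation_def by (intro measurable_linked measurable_open_edges)
    then show ?thesis unfolding B_def by measurable
  qed
  have le: "?\<theta> \<le> prob {\<omega> \<in> space ?M. B n \<omega>}" for n
  proof -
    \<comment> \<open>The edges that meet the ball \<open>S\<close> contain the part of a path up to its first exit from \<open>S\<close>.
      They lie in the larger ball \<open>V\<close>.\<close>
    define S where "S = {x :: int ^ 'd. l1_dist 0 x \<le> int n}"
    define V where "V = {x :: int ^ 'd. l1_dist 0 x \<le> int n + 1}"
    define F where "F = {e \<in> lattice_edges. e \<inter> S \<noteq> {}}"
    define K where "K = card F"
    let ?A = "\<lambda>X. \<exists>x\<in>{0}. \<exists>y\<in>- S. linked X x y"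
    let ?slab = "slab lev F V K"
    let ?R = "reaches_over lev {0} (\<lambda>_. 0) (- S)"
    have finV: "finite V" unfolding V_def by (rule finite_l1_ball)
    have F_edge: "\<exists>x\<in>V. \<exists>y\<in>V. x \<noteq> y \<and> e = {x, y}" if "e \<in> F" for e
    proof -
      from that obtain x y where xy: "e = {x, y}" "l1_dist x y = 1" "x \<in> S \<or> y \<in> S"
        by (auto simp: F_def lattice_edges_def)
      then have "x \<in> V" "y \<in> V"
        using l1_dist_triangle[of 0 x y] l1_dist_triangle[of 0 y x]
        by (auto simp: S_def V_def l1_dist_commute[of y x])
      moreover have "x \<noteq> y" using xy by auto
      ultimately show ?thesis using xy by blast
    qed
    have "F \<subseteq> Pow V" using F_edge by blast
    then have finF: "finite F" using finV by (simp add: finite_subset)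
    have F_lattice: "F \<subseteq> lattice_edges" by (auto simp: F_def)
    have slab_edges: "?slab \<subseteq> ?E"
    proof
      fix e assume "e \<in> ?slab"
      then consider (floor) f k where "f \<in> F" "e = f \<times> {lev k}"
        | (rung) x k where "e = {x} \<times> {lev k, lev (Suc k)}"
        by (auto simp: slab_def)
      then show "e \<in> ?E"
      proof cases
        case floor
        then have "f \<in> lattice_edges" using F_lattice by blast
        then obtain x y where xy: "f = {x, y}" "l1_dist x y = 1"
          unfolding lattice_edges_def by blast
        have "e = {(x, lev k), (y, lev k)}" using floor xy by auto
        then show ?thesis using prod_lattice_edges_fst[OF xy(2)] by simp
      next
        case rung
        then have "e = {(x, lev k), (x, lev (Suc k))}" by auto
        then show ?thesis by (simp add: lev_Suc prod_lattice_edges_snd)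
      qed
    qed
    have "?\<theta> \<le> N.prob {\<omega> \<in> space ?N. ?A {e \<in> F. \<omega> e}}"
    proof (rule N.finite_measure_mono)
      show "{\<omega> \<in> space ?N. infinite (open_cluster lattice_edges \<omega> 0)} \<subseteq> {\<omega> \<in> space ?N. ?A {e \<in> F. \<omega> e}}"
      proof (clarsimp)
        fix \<omega> assume inf: "infinite (open_cluster lattice_edges \<omega> (0 :: int ^ 'd))"
        obtain y where "y \<in> open_cluster lattice_edges \<omega> 0" "l1_dist 0 y \<ge> int n + 1"
          using infinite_l1_unbounded[OF inf] by blast
        then have "linked {e \<in> lattice_edges. \<omega> e} 0 y" "y \<notin> S"
          by (auto simp: open_cluster_eq S_def)
        moreover have "0 \<in> S" by (simp add: S_def)
        ultimately obtain w where "w \<notin> S" "linked {e \<in> {e \<in> lattice_edges. \<omega> e}. e \<inter> S \<noteq> {}} 0 w"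
          using linked_first_exit[of "{e \<in> lattice_edges. \<omega> e}" 0 y S] by auto
        moreover have "{e \<in> {e \<in> lattice_edges. \<omega> e}. e \<inter> S \<noteq> {}} = {e \<in> F. \<omega> e}"
          by (auto simp: F_def)
        ultimately show "\<exists>y\<in>- S. linked {e \<in> F. \<omega> e} 0 y" by auto
      qed
      have "Measurable.pred ?N (\<lambda>\<omega>. {x, y} \<in> {e \<in> F. \<omega> e})" for x y
      proof (cases "{x, y} \<in> F")
        case True
        then have "{x, y} \<in> lattice_edges" using F_lattice by auto
        then show ?thesis
          using True measurable_edge_state unfolding homogeneous_percolation_def by auto
      qed simp
      then have "Measurable.pred ?N (\<lambda>\<omega>. linked {e \<in> F. \<omega> e} x y)" for x y
        by (rule measurable_linked)
      then have "Measurable.pred ?N (\<lambda>\<omega>. \<exists>y. y \<in> - S \<and> linked {e \<in> F. \<omega> e} 0 y)"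
        by (intro pred_intros_countable pred_intros_logic) simp_all
      moreover have "{\<omega> \<in> space ?N. ?A {e \<in> F. \<omega> e}} =
          {\<omega> \<in> space ?N. \<exists>y. y \<in> - S \<and> linked {e \<in> F. \<omega> e} 0 y}" by auto
      ultimately show "{\<omega> \<in> space ?N. ?A {e \<in> F. \<omega> e}} \<in> N.events" by (simp only: pred_def)
    qed
    also have "\<dots> = bernoulli_prob F (\<lambda>_. p + (1 - p) * a * p) ?A"
      using prob_finite_restriction[OF finF F_lattice, of "\<lambda>_. p'" ?A] p'01
      unfolding homogeneous_percolation_def p' a_def by simp
    also have "\<dots> \<le> bernoulli_prob ?slab (slab_param p a F) ?R"
      by (rule exploration_comparison[OF p a lev finV finF F_edge]) (simp_all add: K_def)
    also have "\<dots> \<le> bernoulli_prob ?slab ?r ?R"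
    proof (rule bernoulli_prob_mono_param[OF finite_slab[OF finF finV] _ reaches_over_mono])
      fix e assume "e \<in> ?slab"
      then consider (floor) f k where "f \<in> F" "e = f \<times> {lev k}"
        | (rung) x k where "e = {x} \<times> {lev k, lev (Suc k)}"
        by (auto simp: slab_def)
      then show "0 \<le> slab_param p a F e \<and> slab_param p a F e \<le> ?r e \<and> ?r e \<le> 1"
      proof cases
        case floor
        obtain x y where xy: "f = {x, y}" "x \<noteq> y" using F_edge[OF floor(1)] by blast
        have "e = {(x, lev k), (y, lev k)}" using floor xy by auto
        then have "differ_only_in_fst e" using differ_only_in_fst_fst[OF xy(2)] by simp
        moreover have "slab_param p a F e = p"
          using floor xy by (simp add: slab_param_def snd_image_times)
        ultimately show ?thesis using p by simp
      next
        case rung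
        let ?c = "card {f \<in> F. fst ` e \<subseteq> f}"
        have "e = {(x, lev k), (x, lev (Suc k))}" using rung by auto
        then have "\<not> differ_only_in_fst e" using differ_only_in_fst_snd by simp
        moreover have "slab_param p a F e = 1 - (1 - a) ^ ?c"
          using rung inj_eq[OF lev] by (simp add: slab_param_def snd_image_times)
        moreover have "1 - (1 - a) ^ ?c \<le> q"
        proof -
          have "{f \<in> F. fst ` e \<subseteq> f} \<subseteq> (\<lambda>y. {x, y}) ` neighbours x"
          proof
            fix f assume f: "f \<in> {f \<in> F. fst ` e \<subseteq> f}"
            then have "f \<in> lattice_edges" using F_lattice by blast
            then obtain y z where yz: "f = {y, z}" "l1_dist y z = 1"
              unfolding lattice_edges_def by blast
            have "x \<in> f" using f rung by (simp add: fst_image_times)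
            then consider "x = y" | "x = z" using yz(1) by blast
            then show "f \<in> (\<lambda>y. {x, y}) ` neighbours x"
            proof cases
              case 1
              show ?thesis
                by (rule image_eqI[of _ _ z]) (use 1 yz in \<open>simp_all add: neighbours_def\<close>)
            next
              case 2
              show ?thesis
                by (rule image_eqI[of _ _ y])
                  (use 2 yz l1_dist_commute[of y z] in \<open>simp_all add: neighbours_def insert_commute\<close>)
            qed
          qed
          then have "?c \<le> card ((\<lambda>y. {x, y}) ` neighbours x)" by (intro card_mono) auto
          also have "\<dots> \<le> card (neighbours x)" by (rule card_image_le) simp
          also have "\<dots> \<le> 2 * CARD('d)" by (rule card_neighbours_le)
          finally have "real ?c \<le> real (2 * CARD('d))" by (rule of_nat_mono)
          then have "real ?c \<le> 2 * real CARD('d)" by simp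
          then have "real ?c * a \<le> 2 * real CARD('d) * a" using a by (intro mult_right_mono) auto
          also have "\<dots> = q" using d by (simp add: a_def)
          finally have "1 - q \<le> 1 + real ?c * (- a)" by simp
          also have "\<dots> \<le> (1 + (- a)) ^ ?c" using a by (intro Bernoulli_inequality) simp
          finally show ?thesis by simp
        qed
        moreover have "0 \<le> slab_param p a F e" using slab_param_bounds[OF p a] by blast
        ultimately show ?thesis using q by simp
      qed
    qed
    also have "\<dots> = prob {\<omega> \<in> space ?M. ?R {e \<in> ?slab. \<omega> e}}"
      unfolding anisotropic_percolation_def using slab_edges
      by (intro prob_finite_restriction[symmetric] finite_slab finF finV) (use p q in auto)
    also have "\<dots> \<le> prob {\<omega> \<in> space ?M. B n \<omega>}"
    proof (rule finite_measure_mono)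
      show "{\<omega> \<in> space ?M. B n \<omega>} \<in> events" using measB by (simp add: pred_def)
      show "{\<omega> \<in> space ?M. ?R {e \<in> ?slab. \<omega> e}} \<subseteq> {\<omega> \<in> space ?M. B n \<omega>}"
      proof (clarsimp)
        fix \<omega> assume "?R {e \<in> ?slab. \<omega> e}"
        then obtain y u where yu: "y \<notin> S" "linked {e \<in> ?slab. \<omega> e} (0, 0) (y, u)"
          by (auto simp: reaches_over_def lev0)
        have "{e \<in> ?slab. \<omega> e} \<subseteq> {e \<in> ?E. \<omega> e}" using slab_edges by auto
        then have "linked {e \<in> ?E. \<omega> e} (0, 0) (y, u)" using yu(2) by (rule linked_mono[rotated])
        then show "B n \<omega>" using yu(1) by (auto simp: B_def S_def not_le)
      qed
    qed
    finally show ?thesis .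
  qed
  have "B n \<omega>" if "B (Suc n) \<omega>" for n \<omega>
  proof -
    from that obtain y u where "l1_dist 0 y > int (Suc n)" "linked {e \<in> ?E. \<omega> e} (0, 0) (y, u)"
      unfolding B_def by blast
    moreover from this(1) have "l1_dist 0 y > int n" by linarith
    ultimately show ?thesis unfolding B_def by blast
  qed
  then have "decseq (\<lambda>n. {\<omega> \<in> space ?M. B n \<omega>})" by (intro decseq_SucI Collect_mono) simp
  moreover have "range (\<lambda>n. {\<omega> \<in> space ?M. B n \<omega>}) \<subseteq> events"
    using measB by (intro image_subsetI) (simp add: pred_def)
  ultimately have "(\<lambda>n. prob {\<omega> \<in> space ?M. B n \<omega>}) \<longlonglongrightarrow> prob (\<Inter>n. {\<omega> \<in> space ?M. B n \<omega>})"
    by (intro finite_Lim_measure_decseq)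
  then have "?\<theta> \<le> prob (\<Inter>n. {\<omega> \<in> space ?M. B n \<omega>})"
    by (rule LIMSEQ_le_const) (intro exI[of _ 0] allI impI le)
  also have "\<dots> \<le> prob {\<omega> \<in> space ?M. infinite (open_cluster ?E \<omega> (0, 0))}"
  proof (rule finite_measure_mono)
    have "Measurable.pred ?M (\<lambda>\<omega>. infinite (open_cluster ?E \<omega> (0, 0)))"
      unfolding open_cluster_eq anisotropic_percolation_def
      by (intro measurable_infinite_cluster measurable_open_edges)
    then show "{\<omega> \<in> space ?M. infinite (open_cluster ?E \<omega> (0, 0))} \<in> events" by measurable
    show "(\<Inter>n. {\<omega> \<in> space ?M. B n \<omega>}) \<subseteq> {\<omega> \<in> space ?M. infinite (open_cluster ?E \<omega> (0, 0))}"
    proof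
      fix \<omega> assume \<omega>: "\<omega> \<in> (\<Inter>n. {\<omega> \<in> space ?M. B n \<omega>})"
      have "infinite (open_cluster ?E \<omega> (0, 0))"
      proof
        assume fin: "finite (open_cluster ?E \<omega> (0, 0))"
        define D where "D = (\<lambda>z. nat (l1_dist 0 (fst z))) ` open_cluster ?E \<omega> (0, 0)"
        have "finite D" using fin by (simp add: D_def)
        from \<omega> have "B (Max D) \<omega>" by auto
        then obtain y u where yu: "l1_dist 0 y > int (Max D)" "(y, u) \<in> open_cluster ?E \<omega> (0, 0)"
          by (auto simp: B_def open_cluster_eq)
        then have "nat (l1_dist 0 y) \<in> D" by (force simp: D_def)
        then have "nat (l1_dist 0 y) \<le> Max D" using \<open>finite D\<close> by simp
        with yu(1) show False by linarith
      qed
      then show "\<omega> \<in> {\<omega> \<in> space ?M. infinite (open_cluster ?E \<omega> (0, 0))}" using \<omega> by auto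
    qed
  qed
  finally show ?thesis .
qed

section \<open>Percolation near the critical threshold\<close>

theorem theorem1:
  "\<exists>\<epsilon>>0. \<forall>p\<in>{0..1}. \<forall>q\<in>{0..1}.
     0 < critical_threshold TYPE('d::finite) - p \<longrightarrow>
     critical_threshold TYPE('d) - p < \<epsilon> \<longrightarrow>
     q \<ge> 8 * (real CARD('d))\<^sup>2 * (critical_threshold TYPE('d) - p) \<longrightarrow>
     (AE \<omega> in (anisotropic_percolation p q ::
                 (((int ^ 'd) \<times> (int ^ 's::finite)) set \<Rightarrow> bool) measure).
        \<exists>C\<in>open_clusters prod_lattice_edges \<omega>. infinite C)"
proof -
  let ?pc = "critical_threshold TYPE('d)" and ?d = "real CARD('d)"
  have percolates: "AE \<omega> in (anisotropic_percolation p q ::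
        (((int ^ 'd) \<times> (int ^ 's::finite)) set \<Rightarrow> bool) measure).
        \<exists>C\<in>open_clusters prod_lattice_edges \<omega>. infinite C"
    if "p \<in> {0..1}" "q \<in> {0..1}"
      "0 < \<P>(\<omega> in (anisotropic_percolation p q :: (((int ^ 'd) \<times> (int ^ 's)) set \<Rightarrow> bool) measure).
        infinite (open_cluster prod_lattice_edges \<omega> (0, 0)))" for p q
    using that unfolding anisotropic_percolation_def
    by (intro AE_infinite_cluster[OF countable_prod_lattice_edges]) auto
  show ?thesis
  proof (cases "CARD('d) = 1")
    case True
    then have pc: "?pc = 1"
      using critical_threshold_ge[where 'd = 'd] critical_threshold_leI[where 'd = 'd, of 1] by simp
    have "0 < \<P>(\<omega> in (anisotropic_percolation p q :: (((int ^ 'd) \<times> (int ^ 's)) set \<Rightarrow> bool) measure).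
        infinite (open_cluster prod_lattice_edges \<omega> (0, 0)))"
      if pq: "p \<in> {0..1}" "q \<in> {0..1}" "0 < ?pc - p" "q \<ge> 8 * ?d\<^sup>2 * (?pc - p)" for p q
    proof (rule planar_anisotropic)
      have q: "0 < q" "8 * (1 - p) \<le> q" using pq True pc by auto
      have "2 * (1 - p) * (2 - q) < 2 * (1 - p) * 2" using q pq pc by (intro mult_strict_left_mono) auto
      then have "2 * (1 - p) * (2 - q) < q / 2" using q by linarith
      then show "2 * (1 - p) / q * (2 - q) < 1 / 2" using q by (simp add: field_simps)
      show "0 < q" by (rule q)
    qed (use pq in auto)
    then show ?thesis using percolates by (intro exI[of _ 1]) auto
  next
    case False
    moreover have "CARD('d) \<noteq> 0" by simp
    ultimately have d2: "CARD('d) \<ge> 2" by linarith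
    then have d: "?d \<ge> 2" by simp
    have pc: "1 / (2 * ?d - 1) \<le> ?pc" "?pc \<le> 5 / 6"
      using critical_threshold_ge critical_threshold_le[OF d2] by auto
    have pc_pos: "0 < ?pc" using pc(1) d by (smt (verit) divide_pos_pos)
    \<comment> \<open>For \<open>p\<^sub>c \<le> 1 / 2\<close> this follows from the lower bound on the threshold, otherwise from the upper one.\<close>
    have key: "1 < 4 * ?d * ?pc * (1 - ?pc)"
    proof (cases "?pc \<le> 1 / 2")
      case True
      have "1 \<le> (2 * ?d - 1) * ?pc" using pc(1) d by (simp add: divide_le_eq mult.commute)
      then have "1 < 2 * ?d * ?pc" using pc_pos by (simp add: algebra_simps)
      also have "\<dots> = 4 * ?d * ?pc * (1 / 2)" by simp
      also have "\<dots> \<le> 4 * ?d * ?pc * (1 - ?pc)"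
        using True pc_pos d by (intro mult_left_mono) auto
      finally show ?thesis .
    next
      case False
      have "0 \<le> (?pc - 1 / 6) * (5 / 6 - ?pc)" using False pc by (intro mult_nonneg_nonneg) auto
      also have "\<dots> = ?pc * (1 - ?pc) - 5 / 36" by (simp add: field_simps)
      finally have "5 / 36 \<le> ?pc * (1 - ?pc)" by simp
      then have "4 * 2 * (5 / 36) \<le> 4 * ?d * (?pc * (1 - ?pc))" using d by (intro mult_mono) auto
      then have "1 < 4 * ?d * (?pc * (1 - ?pc))" by linarith
      then show ?thesis by (simp only: mult.assoc)
    qed
    \<comment> \<open>Chosen so that \<open>p > p\<^sub>c - \<epsilon>\<close> means \<open>4 d p (1 - p\<^sub>c) > 1\<close>.\<close>
    define \<epsilon> where "\<epsilon> = ?pc - 1 / (4 * ?d * (1 - ?pc))"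
    have den: "0 < 4 * ?d * (1 - ?pc)" using d pc by simp
    have "0 < \<epsilon>" using key den unfolding \<epsilon>_def by (simp add: divide_less_eq mult_ac)
    moreover have "0 < \<P>(\<omega> in (anisotropic_percolation p q :: (((int ^ 'd) \<times> (int ^ 's)) set \<Rightarrow> bool) measure).
        infinite (open_cluster prod_lattice_edges \<omega> (0, 0)))"
      if pq: "p \<in> {0..1}" "q \<in> {0..1}" "0 < ?pc - p" "?pc - p < \<epsilon>" "q \<ge> 8 * ?d\<^sup>2 * (?pc - p)" for p q
    proof -
      define p' where "p' = p + (1 - p) * (q / (2 * ?d)) * p"
      have "1 / (4 * ?d * (1 - ?pc)) < p" using pq by (simp add: \<epsilon>_def)
      then have "1 < p * (4 * ?d * (1 - ?pc))" using den by (simp add: divide_less_eq)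
      also have "\<dots> \<le> p * (4 * ?d * (1 - p))" using pq d by (intro mult_left_mono) auto
      finally have gain: "1 < p * (4 * ?d * (1 - p))" .
      have "4 * ?d * (?pc - p) = 8 * ?d\<^sup>2 * (?pc - p) / (2 * ?d)" using d by (simp add: power2_eq_square)
      also have "\<dots> \<le> q / (2 * ?d)" using pq d by (intro divide_right_mono) auto
      finally have "(1 - p) * p * (4 * ?d * (?pc - p)) \<le> (1 - p) * p * (q / (2 * ?d))"
        using pq by (intro mult_left_mono) auto
      moreover have "1 * (?pc - p) < p * (4 * ?d * (1 - p)) * (?pc - p)"
        using gain pq by (intro mult_strict_right_mono) auto
      ultimately have "?pc < p'" by (simp add: p'_def mult_ac)
      moreover have "p' \<le> 1"
      proof -
        have "q / (2 * ?d) \<le> 1" using pq d by (simp add: divide_le_eq)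
        then have "q / (2 * ?d) * p \<le> 1" using pq d by (intro mult_le_one) auto
        then have "(1 - p) * (q / (2 * ?d) * p) \<le> (1 - p) * 1" using pq by (intro mult_left_mono) auto
        then show ?thesis by (simp add: p'_def mult.assoc)
      qed
      ultimately have "0 < \<P>(\<omega> in (homogeneous_percolation p' :: ((int ^ 'd) set \<Rightarrow> bool) measure).
          infinite (open_cluster lattice_edges \<omega> 0))"
        by (rule prob_infinite_cluster_pos)
      also have "\<dots> \<le> \<P>(\<omega> in (anisotropic_percolation p q :: (((int ^ 'd) \<times> (int ^ 's)) set \<Rightarrow> bool) measure).
          infinite (open_cluster prod_lattice_edges \<omega> (0, 0)))"
        by (rule anisotropic_dominates) (use pq in \<open>auto simp: p'_def\<close>)
      finally show ?thesis .
    qed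
    ultimately show ?thesis using percolates by (intro exI[of _ \<epsilon>]) blast
  qed
qed

end
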